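(* Let $g>0$, $\Omega>0$, $d>0$, $\rho_0>0$, $\rho_1>0$ with $\rho_0\ne\rho_1$, and let $\rho(x)=\rho_1$ for $|x|\le d$ and $\rho(x)=\rho_0$ for $|x|>d$. For $j=0,1$ set $\lambda_j(\omega)=\omega-\frac{g^2\rho_j}{\omega-\Omega}$ and $\omega_{j,\pm}=\frac12\left(\Omega\pm\sqrt{\Omega^2+4g^2\rho_j}\right)$. Every eigenvalue $\omega$ satisfies $\lambda_0(\omega)<0$ and $\lambda_1(\omega)>0$; for such $\omega$ put $\kappa(\omega)=\sqrt{-\lambda_0(\omega)}$ and $q(\omega)=\sqrt{\lambda_1(\omega)}$. Then such an $\omega$ is an eigenvalue with an even eigenfunction if and only if $q(\omega)\tan(q(\omega)d)=\kappa(\omega)$, and an eigenvalue with an odd eigenfunction if and only if $-q(\omega)\cot(q(\omega)d)=\kappa(\omega)$. Moreover: (i) If $\rho_1>\rho_0$, all eigenvalues lie in $(\omega_{1,-},\omega_{0,-})$, and the total number of eigenvalues equals the cardinality of $$\left\{m\in\mathbb{Z}_{\ge0}\ :\ \frac{m\pi}{2}<K_-d\right\},\qquad K_-=\sqrt{\frac{g^2(\rho_1-\rho_0)}{\Omega-\omega_{0,-}}}.$$ (ii) If $\rho_1<\rho_0$, all eigenvalues lie in $(\omega_{1,+},\omega_{0,+})$, and the total number of eigenvalues equals the cardinality of $$\left\{m\in\mathbb{Z}_{\ge0}\ :\ \frac{m\pi}{2}<K_+d\right\},\qquad K_+=\sqrt{\frac{g^2(\rho_0-\rho_1)}{\ome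ga_{0,+}-\Omega}}.$$
   Context: A real $\omega\neq\Omega$ is called an eigenvalue (bound-state frequency) if the equation $-\psi''+\frac{g^2\rho(x)}{\omega-\Omega}\psi=\omega\psi$ has a nonzero solution $\psi\in L^2(\mathbb{R})$ that is continuously differentiable on $\mathbb{R}$ and satisfies the equation on $\mathbb{R}\setminus\{-d,d\}$; such a $\psi$ is called an eigenfunction. Eigenvalues are counted as distinct values of $\omega$. *)

theory Defs
  imports "HOL-Analysis.Analysis"
begin

definition atom_density :: "real \<Rightarrow> real \<Rightarrow> real \<Rightarrow> real \<Rightarrow> real" where
  "atom_density d \<rho>0 \<rho>1 x = (if \<bar>x\<bar> \<le> d then \<rho>1 else \<rho>0)"

definition square_integrable :: "(real \<Rightarrow> complex) \<Rightarrow> bool" where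
  "square_integrable \<psi> \<longleftrightarrow>
     \<psi> \<in> borel_measurable lborel \<and> integrable lborel (\<lambda>x. (cmod (\<psi> x))\<^sup>2)"

definition is_eigenfunction ::
    "real \<Rightarrow> real \<Rightarrow> real \<Rightarrow> real \<Rightarrow> real \<Rightarrow> real \<Rightarrow> (real \<Rightarrow> complex) \<Rightarrow> bool" where
  "is_eigenfunction g \<Omega> d \<rho>0 \<rho>1 \<omega> \<psi> \<longleftrightarrow>
     \<omega> \<noteq> \<Omega> \<and>
     (\<exists>x. \<psi> x \<noteq> 0) \<and>
     square_integrable \<psi> \<and>
     \<psi> C1_differentiable_on UNIV \<and>
     (\<forall>x. x \<notin> {-d, d} \<longrightarrow>
        (\<exists>\<psi>2. ((\<lambda>t. vector_derivative \<psi> (at t)) has_vector_derivative \<psi>2) (at x) \<and>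
              - \<psi>2 + (g\<^sup>2 * atom_density d \<rho>0 \<rho>1 x / (\<omega> - \<Omega>)) *\<^sub>R \<psi> x = \<omega> *\<^sub>R \<psi> x))"

definition is_eigenvalue :: "real \<Rightarrow> real \<Rightarrow> real \<Rightarrow> real \<Rightarrow> real \<Rightarrow> real \<Rightarrow> bool" where
  "is_eigenvalue g \<Omega> d \<rho>0 \<rho>1 \<omega> \<longleftrightarrow> (\<exists>\<psi>. is_eigenfunction g \<Omega> d \<rho>0 \<rho>1 \<omega> \<psi>)"

definition even_function :: "(real \<Rightarrow> complex) \<Rightarrow> bool" where
  "even_function \<psi> \<longleftrightarrow> (\<forall>x. \<psi> (- x) = \<psi> x)"

definition odd_function :: "(real \<Rightarrow> complex) \<Rightarrow> bool" where
  "odd_function \<psi> \<longleftrightarrow> (\<forall>x. \<psi> (- x) = - \<psi> x)"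

definition lam :: "real \<Rightarrow> real \<Rightarrow> real \<Rightarrow> real \<Rightarrow> real" where
  "lam g \<Omega> \<rho> \<omega> = \<omega> - g\<^sup>2 * \<rho> / (\<omega> - \<Omega>)"

definition omega_minus :: "real \<Rightarrow> real \<Rightarrow> real \<Rightarrow> real" where
  "omega_minus g \<Omega> \<rho> = 1/2 * (\<Omega> - sqrt (\<Omega>\<^sup>2 + 4 * g\<^sup>2 * \<rho>))"

definition omega_plus :: "real \<Rightarrow> real \<Rightarrow> real \<Rightarrow> real" where
  "omega_plus g \<Omega> \<rho> = 1/2 * (\<Omega> + sqrt (\<Omega>\<^sup>2 + 4 * g\<^sup>2 * \<rho>))"

(* Isabelle's sqrt is odd on the negative reals, so kappa and wavenumber have their intended
   meaning only where lam at \<rho>0 is negative and lam at \<rho>1 is positive. There kappa is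
   positive, so the junk value 0 of tan and cot at a pole never solves the equations
   for bound states: these count as false at poles. *)
definition kappa :: "real \<Rightarrow> real \<Rightarrow> real \<Rightarrow> real \<Rightarrow> real" where
  "kappa g \<Omega> \<rho>0 \<omega> = sqrt (- lam g \<Omega> \<rho>0 \<omega>)"

definition wavenumber :: "real \<Rightarrow> real \<Rightarrow> real \<Rightarrow> real \<Rightarrow> real" where
  "wavenumber g \<Omega> \<rho>1 \<omega> = sqrt (lam g \<Omega> \<rho>1 \<omega>)"

definition K_minus :: "real \<Rightarrow> real \<Rightarrow> real \<Rightarrow> real \<Rightarrow> real" where
  "K_minus g \<Omega> \<rho>0 \<rho>1 = sqrt (g\<^sup>2 * (\<rho>1 - \<rho>0) / (\<Omega> - omega_minus g \<Omega> \<rho>0))"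

definition K_plus :: "real \<Rightarrow> real \<Rightarrow> real \<Rightarrow> real \<Rightarrow> real" where
  "K_plus g \<Omega> \<rho>0 \<rho>1 = sqrt (g\<^sup>2 * (\<rho>0 - \<rho>1) / (omega_plus g \<Omega> \<rho>0 - \<Omega>))"

end

(* The real and imaginary parts of an eigenfunction are square-integrable real solutions u of
   u'' = - lam u.  A lam at \<rho>0 that is nonnegative leaves no such u outside the well except 0; a
   negative one forces u' = - kappa u at the right edge and u' = kappa u at the left one.  A lam at
   \<rho>1 that is nonpositive is then excluded by the convexity of u^2 on the well.  In the remaining
   case u = a cos (q x) + b sin (q x) on the well, and the edge conditions decouple into one
   for a and one for b: the tangent and the cotangent equation.  Both together say that the phase
   q d - arctan (kappa / q) is a multiple of \<pi>/2.  The phase increases strictly in \<omega> from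
   - \<pi>/2 to K d across the window of admissible \<omega>, so the multiples m \<pi>/2 attained are those
   with m \<ge> 0 and m \<pi>/2 < K d, each exactly once. *)
theory Submission
  imports Defs
begin

section \<open>Linear second-order equations with constant coefficients\<close>

text \<open>An interval of length n in the ray contributes at least c n, so a positive c would make
  the integral exceed every bound. Solutions that do not decay are excluded this way.\<close>

lemma not_integrable_if_bounded_below_on_ray:
  fixes f :: "real \<Rightarrow> real"
  assumes int: "integrable lborel f" and nonneg: "\<And>x. 0 \<le> f x"
    and ray: "\<And>x. M \<le> x \<Longrightarrow> c \<le> f x"
  shows "c \<le> 0"
proof (rule ccontr)
  assume "\<not> c \<le> 0"
  then have c: "c > 0" by simp
  have *: "c * real n \<le> integral\<^sup>L lborel f" for n :: nat
  proof -
    have "(\<integral>x. c * indicator {M..M + real n} x \<partial>lborel) \<le> integral\<^sup>L lborel f"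
      by (intro integral_mono int integrable_mult_right integrable_real_indicator)
         (use nonneg ray in \<open>auto simp: indicator_def\<close>)
    then show ?thesis by simp
  qed
  obtain n :: nat where "integral\<^sup>L lborel f / c < real n"
    using reals_Archimedean2 by blast
  then show False using *[of n] c by (simp add: field_simps)
qed

text \<open>Agreement of values and slopes at \<open>c\<close> makes the glued function
  differentiable at the junction as well.\<close>

lemma has_real_derivative_glue:
  fixes g h :: "real \<Rightarrow> real"
  assumes g: "\<And>x. (g has_real_derivative g' x) (at x)"
    and h: "\<And>x. (h has_real_derivative h' x) (at x)"
    and "g c = h c" "g' c = h' c"
  shows "((\<lambda>x. if x \<le> c then g x else h x) has_real_derivative (if x \<le> c then g' x else h' x)) (at x)"
proof -
  have "((\<lambda>x. if x \<in> {..c} then g x else h x) has_vector_derivative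
          (if x \<in> {..c} then g' x else h' x)) (at x within UNIV)"
    by (rule has_vector_derivative_If_within_closures[where T = "{c<..}"])
       (use assms in \<open>auto simp flip: has_real_derivative_iff_has_vector_derivative
            intro: has_field_derivative_at_within\<close>)
  then show ?thesis
    by (simp add: has_real_derivative_iff_has_vector_derivative)
qed

text \<open>Both u cos (k x) - (v / k) sin (k x) and u sin (k x) + (v / k) cos (k x) have derivative
  zero; rotating back by the angle k B recovers \<open>u\<close> and \<open>v\<close>. Derivatives
  are asked only in the open interval, so an edge of the well may serve as an end point.\<close>

lemma harmonic_solution:
  fixes u v :: "real \<Rightarrow> real"
  assumes k: "k \<noteq> 0" and AB: "A \<le> B"
    and cont: "continuous_on {A..B} u" "continuous_on {A..B} v"
    and du: "\<And>x. A < x \<Longrightarrow> x < B \<Longrightarrow> (u has_real_derivative v x) (at x)"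
    and dv: "\<And>x. A < x \<Longrightarrow> x < B \<Longrightarrow> (v has_real_derivative - k\<^sup>2 * u x) (at x)"
    and a: "a = u A * cos (k * A) - v A / k * sin (k * A)"
    and b: "b = u A * sin (k * A) + v A / k * cos (k * A)"
  shows "u B = a * cos (k * B) + b * sin (k * B)"
    and "v B = k * (b * cos (k * B) - a * sin (k * B))"
proof -
  have "u B * cos (k * B) - v B / k * sin (k * B) = a
      \<and> u B * sin (k * B) + v B / k * cos (k * B) = b"
  proof (cases "A = B")
    case False
    with AB have AB: "A < B" by simp
    have "u B * cos (k * B) - v B / k * sin (k * B) = u A * cos (k * A) - v A / k * sin (k * A)"
      by (rule DERIV_isconst_end[OF AB])
         (use k in \<open>auto intro!: continuous_intros cont derivative_eq_intros du dv
            simp: power2_eq_square field_simps\<close>)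
    moreover have "u B * sin (k * B) + v B / k * cos (k * B)
        = u A * sin (k * A) + v A / k * cos (k * A)"
      by (rule DERIV_isconst_end[OF AB])
         (use k in \<open>auto intro!: continuous_intros cont derivative_eq_intros du dv
            simp: power2_eq_square field_simps\<close>)
    ultimately show ?thesis using a b by simp
  qed (use a b in auto)
  then have a': "a = u B * cos (k * B) - v B / k * sin (k * B)"
    and b': "b = u B * sin (k * B) + v B / k * cos (k * B)" by auto
  obtain C S where CS: "cos (k * B) = C" "sin (k * B) = S" "C\<^sup>2 + S\<^sup>2 = 1"
    by simp
  have "u B = u B * (C\<^sup>2 + S\<^sup>2)"
    using CS by simp
  also have "\<dots> = a * cos (k * B) + b * sin (k * B)"
    unfolding a' b' CS(1,2) by (simp add: algebra_simps power2_eq_square)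
  finally show "u B = a * cos (k * B) + b * sin (k * B)" .
  have "v B = k * (v B / k * (C\<^sup>2 + S\<^sup>2))"
    using k CS by simp
  also have "\<dots> = k * (b * cos (k * B) - a * sin (k * B))"
    unfolding a' b' CS(1,2) by (simp add: algebra_simps power2_eq_square)
  finally show "v B = k * (b * cos (k * B) - a * sin (k * B))" .
qed

text \<open>The product w exp (- k x) is constant. Second-order equations come under this rule
  through the combinations v + k u and v - k u.\<close>

lemma exponential_solution:
  fixes w :: "real \<Rightarrow> real"
  assumes AB: "A \<le> B" and cont: "continuous_on {A..B} w"
    and dw: "\<And>x. A < x \<Longrightarrow> x < B \<Longrightarrow> (w has_real_derivative k * w x) (at x)"
  shows "w B = w A * exp (k * (B - A))"
proof (cases "A = B")
  case False
  with AB have AB: "A < B" by simp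
  have "w B * exp (- k * B) = w A * exp (- k * A)"
    by (rule DERIV_isconst_end[OF AB])
       (auto intro!: continuous_intros cont derivative_eq_intros dw simp: field_simps)
  then have "w B * exp (- k * B) * exp (k * B) = w A * exp (- k * A) * exp (k * B)" by simp
  then show ?thesis by (simp add: mult.assoc algebra_simps flip: exp_add)
qed simp

section \<open>Square-integrable modes\<close>

text \<open>A real solution is kept as a pair of \<open>u\<close> and its slope \<open>v\<close>; at
  the edges \<open>v\<close> is only required to be continuous, since the coefficient jumps there.
  The signs of \<open>l0\<close> and \<open>l1\<close> are left open and \<open>u\<close> may be
  zero, so that excluded signs appear as vanishing statements.\<close>

locale mode =
  fixes d l0 l1 :: real and u v :: "real \<Rightarrow> real"
  assumes d_pos: "d > 0"
    and du: "\<And>x. (u has_real_derivative v x) (at x)"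
    and cont_v: "continuous_on UNIV v"
    and dv_in: "\<And>x. \<bar>x\<bar> < d \<Longrightarrow> (v has_real_derivative - l1 * u x) (at x)"
    and dv_out: "\<And>x. \<bar>x\<bar> > d \<Longrightarrow> (v has_real_derivative - l0 * u x) (at x)"
    and sq: "integrable lborel (\<lambda>x. (u x)\<^sup>2)"
begin

lemma cont_u: "continuous_on S u"
  by (meson DERIV_continuous_on du has_field_derivative_at_within)

lemma cont_v_on: "continuous_on S v"
  using cont_v continuous_on_subset by blast

text \<open>Transfers every statement about the right ray to the left one; the chain rule accounts
  for the sign of the slope.\<close>

lemma mode_reflect: "mode d l0 l1 (\<lambda>x. u (- x)) (\<lambda>x. - v (- x))"
proof
  show "((\<lambda>x. u (- x)) has_real_derivative - v (- x)) (at x)" for x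
    using du[of "- x"] by (simp add: DERIV_mirror)
  show "continuous_on UNIV (\<lambda>x. - v (- x))"
    by (intro continuous_intros continuous_on_compose2[OF cont_v]) auto
  show "((\<lambda>x. - v (- x)) has_real_derivative - l1 * u (- x)) (at x)" if "\<bar>x\<bar> < d" for x
    using DERIV_minus[OF dv_in[of "- x", unfolded DERIV_mirror]] that by simp
  show "((\<lambda>x. - v (- x)) has_real_derivative - l0 * u (- x)) (at x)" if "\<bar>x\<bar> > d" for x
    using DERIV_minus[OF dv_out[of "- x", unfolded DERIV_mirror]] that by simp
  show "integrable lborel (\<lambda>x. (u (- x))\<^sup>2)"
    using lborel_integrable_real_affine[OF sq, of "-1" 0] by simp
qed (rule d_pos)

text \<open>For \<open>l0 > 0\<close> the function \<open>u\<close> is sinusoidal with wave number \<open>k\<close> on the ray, so the squares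
  of its values a quarter period apart add up to a constant, which cannot be integrable.\<close>

lemma zero_right_if_l0_nonneg:
  assumes l0: "l0 \<ge> 0" and x: "x \<ge> d"
  shows "u x = 0"
proof (cases "l0 = 0")
  case True
  \<comment> \<open>For \<open>l0 = 0\<close> the slope is constant and \<open>u\<close> is affine
    on the ray; integrability excludes first a nonzero slope, then a nonzero constant.\<close>
  have v: "v x = v d" if "x \<ge> d" for x
    using exponential_solution[OF that cont_v_on, of 0] dv_out True d_pos by simp
  have u: "u x = u d + v d * (x - d)" if "x \<ge> d" for x
  proof (cases "x = d")
    case False
    have "u x - v d * x = u d - v d * d"
    proof (rule DERIV_isconst_end[where f = "\<lambda>x. u x - v d * x"])
      fix y assume "d < y" "y < x"
      then have "((\<lambda>x. u x - v d * x) has_real_derivative v y - v d) (at y)"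
        by (auto intro!: derivative_eq_intros du)
      then show "((\<lambda>x. u x - v d * x) has_real_derivative 0) (at y)"
        using v[of y] \<open>d < y\<close> by simp
    qed (use False that in \<open>auto intro!: continuous_intros cont_u\<close>)
    then show ?thesis by (simp add: algebra_simps)
  qed simp
  have "v d = 0"
  proof (rule ccontr)
    assume nz: "v d \<noteq> 0"
    \<comment> \<open>Beyond \<open>M\<close> the linear term has size at least 1 + |u d|, which
      leaves |u x| \<ge> 1.\<close>
    define M where "M = max d (d + (1 + \<bar>u d\<bar>) / \<bar>v d\<bar>)"
    have "1 \<le> (u x)\<^sup>2" if x: "M \<le> x" for x
    proof -
      have xd: "x \<ge> d" using x unfolding M_def by linarith
      have "1 + \<bar>u d\<bar> \<le> \<bar>v d\<bar> * (x - d)"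
        using x nz by (simp add: M_def field_simps)
      also have "\<dots> = \<bar>v d * (x - d)\<bar>" using xd by (simp add: abs_mult)
      finally have "1 \<le> \<bar>u x\<bar>" using u[OF xd] by linarith
      then show ?thesis by (metis abs_le_square_iff abs_one one_power2)
    qed
    from not_integrable_if_bounded_below_on_ray[OF sq _ this] show False by simp
  qed
  then have u: "u x = u d" if "x \<ge> d" for x using u[OF that] by simp
  have "(u d)\<^sup>2 \<le> 0"
  proof (rule not_integrable_if_bounded_below_on_ray[OF sq])
    show "(u d)\<^sup>2 \<le> (u x)\<^sup>2" if "d \<le> x" for x using u[OF that] by simp
  qed simp
  then show ?thesis using u[OF x] by simp
next
  case False
  define k where "k = sqrt l0"
  have k: "k > 0" "k\<^sup>2 = l0" using False l0 by (auto simp: k_def)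
  define a where "a = u d * cos (k * d) - v d / k * sin (k * d)"
  define b where "b = u d * sin (k * d) + v d / k * cos (k * d)"
  have u: "u x = a * cos (k * x) + b * sin (k * x)" if "x \<ge> d" for x
    by (rule harmonic_solution[of k d x u v])
       (use k that cont_u cont_v_on du dv_out a_def b_def d_pos in auto)
  have "integrable lborel (\<lambda>x. (u x)\<^sup>2 + (u (x + pi / 2 / k))\<^sup>2)"
    using lborel_integrable_real_affine[OF sq, of 1 "pi/2/k"] sq by (simp add: add.commute)
  moreover have "a\<^sup>2 + b\<^sup>2 = (u x)\<^sup>2 + (u (x + pi / 2 / k))\<^sup>2" if "x \<ge> d" for x
  proof -
    have "k * (x + pi / 2 / k) = k * x + pi / 2" using k by (simp add: field_simps)
    moreover have "x + pi / 2 / k \<ge> d"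
      using that k by (simp add: add_increasing2)
    ultimately have u': "u (x + pi / 2 / k) = - a * sin (k * x) + b * cos (k * x)"
      using u[of "x + pi / 2 / k"] by (simp add: cos_add sin_add)
    have "(u x)\<^sup>2 + (u (x + pi / 2 / k))\<^sup>2 = (a\<^sup>2 + b\<^sup>2) * ((sin (k * x))\<^sup>2 + (cos (k * x))\<^sup>2)"
      unfolding u[OF that] u' by algebra
    then show ?thesis by simp
  qed
  ultimately have "a\<^sup>2 + b\<^sup>2 \<le> 0"
    by (intro not_integrable_if_bounded_below_on_ray[of _ d]) auto
  then have "a = 0" "b = 0" by (auto simp: sum_power2_le_zero_iff)
  then show ?thesis using u[OF x] by simp
qed

text \<open>With k = sqrt (- l0) the combination v + k u obeys w' = k w and grows exponentially
  unless it is zero. The growth passes to \<open>u\<close> because v - k u decays, and integrability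
  forbids it.\<close>

lemma decay_right_if_l0_neg:
  assumes l0: "l0 < 0" and x: "x \<ge> d"
  shows "v x = - sqrt (- l0) * u x"
proof (rule ccontr)
  define k where "k = sqrt (- l0)"
  have k: "k > 0" and l0_eq: "l0 = - (k * k)" using l0 by (auto simp: k_def)
  assume "v x \<noteq> - sqrt (- l0) * u x"
  define A where "A = v x + k * u x"
  define B where "B = v x - k * u x"
  have A: "A \<noteq> 0" using \<open>v x \<noteq> _\<close> by (auto simp: A_def k_def)
  have plus: "v y + k * u y = A * exp (k * (y - x))" if "y \<ge> x" for y
    unfolding A_def
    by (rule exponential_solution[of x y "\<lambda>y. v y + k * u y"])
       (use that x d_pos l0_eq in \<open>auto intro!: continuous_intros cont_u cont_v_on derivative_eq_intros
           du dv_out simp: algebra_simps\<close>)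
  have minus: "v y - k * u y = B * exp (- k * (y - x))" if "y \<ge> x" for y
    unfolding B_def
    by (rule exponential_solution[of x y "\<lambda>y. v y - k * u y"])
       (use that x d_pos l0_eq in \<open>auto intro!: continuous_intros cont_u cont_v_on derivative_eq_intros
           du dv_out simp: algebra_simps\<close>)
  \<comment> \<open>Here 2 k u y = A exp (k (y - x)) - B exp (- k (y - x)). By the choice of
    \<open>M\<close> and exp t \<ge> t the first term has size at least 2 k + |B|, the second at
    most |B|, so |u y| \<ge> 1.\<close>
  define M where "M = max x (x + (2 * k + \<bar>B\<bar>) / \<bar>A\<bar> / k)"
  have "1 \<le> (u y)\<^sup>2" if y: "M \<le> y" for y
  proof -
    have xy: "y \<ge> x" using y by (simp add: M_def)
    have "(2 * k + \<bar>B\<bar>) / \<bar>A\<bar> / k \<le> y - x"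
      using y by (simp add: M_def)
    then have "(2 * k + \<bar>B\<bar>) / \<bar>A\<bar> \<le> k * (y - x)"
      using pos_divide_le_eq[OF k] by (metis mult.commute)
    also have "\<dots> \<le> exp (k * (y - x))"
      using exp_ge_add_one_self[of "k * (y - x)"] by linarith
    finally have *: "2 * k + \<bar>B\<bar> \<le> \<bar>A * exp (k * (y - x))\<bar>"
      using A by (simp add: field_simps abs_mult)
    have "exp (- k * (y - x)) \<le> 1" using xy k by (simp add: mult_nonneg_nonneg)
    then have "\<bar>B * exp (- k * (y - x))\<bar> \<le> \<bar>B\<bar>"
      unfolding abs_mult abs_exp_cancel by (rule mult_left_le) simp
    with * have "2 * k \<le> \<bar>2 * (k * u y)\<bar>"
      using plus[OF xy] minus[OF xy] by linarith
    then have "1 \<le> \<bar>u y\<bar>" using k by (simp add: abs_mult)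
    then show ?thesis by (metis abs_le_square_iff abs_one one_power2)
  qed
  from not_integrable_if_bounded_below_on_ray[OF sq _ this] show False by simp
qed

text \<open>For negative \<open>l0\<close> the decay condition is a first-order equation for
  \<open>u\<close>, so the edge value determines \<open>u\<close> on the whole ray.\<close>

lemma zero_right_if_zero_at_edge:
  assumes x: "x \<ge> d" and "u d = 0"
  shows "u x = 0"
proof (cases "l0 \<ge> 0")
  case False
  have "u x = u d * exp (- sqrt (- l0) * (x - d))"
  proof (rule exponential_solution[OF x cont_u])
    fix y assume "d < y" "y < x"
    then show "(u has_real_derivative - sqrt (- l0) * u y) (at y)"
      using du[of y] decay_right_if_l0_neg[of y] False by simp
  qed
  then show ?thesis using assms by simp
qed (use zero_right_if_l0_nonneg x in auto)

lemma edge_right: "u d * v d \<le> 0"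
proof (cases "l0 \<ge> 0")
  case True
  then show ?thesis using zero_right_if_l0_nonneg[of d] by simp
next
  case False
  then have "u d * v d = - (sqrt (- l0) * (u d)\<^sup>2)"
    using decay_right_if_l0_neg[of d] by (simp add: power2_eq_square)
  then show ?thesis using False by simp
qed

lemma edge_left: "u (- d) * v (- d) \<ge> 0"
  using mode.edge_right[OF mode_reflect] by simp

text \<open>Since \<open>u\<close> vanishes on the ray, \<open>v\<close> vanishes beyond
  \<open>d\<close>, and the continuity of \<open>v\<close> carries this to the edge itself.\<close>

lemma v_zero_right_if_l0_nonneg:
  assumes l0: "l0 \<ge> 0"
  shows "v d = 0"
proof -
  have vx: "v x = 0" if "x > d" for x
  proof -
    have "(u has_real_derivative 0) (at x)"
      by (rule has_field_derivative_transform_within_open[of "\<lambda>_. 0" _ _ "{d<..}"])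
         (use that zero_right_if_l0_nonneg[OF l0] in auto)
    then show ?thesis using du DERIV_unique by blast
  qed
  have "continuous (at_right d) v"
    using cont_v by (simp add: continuous_on_eq_continuous_at continuous_at_imp_continuous_at_within)
  then have "(v \<longlongrightarrow> v d) (at_right d)" by (simp add: continuous_within)
  then have "((\<lambda>_. 0) \<longlongrightarrow> v d) (at_right d)"
    by (rule Lim_transform_eventually) (auto intro: eventually_at_rightI[of d "d + 1"] simp: vx)
  then show ?thesis by (simp add: tendsto_const_iff)
qed

text \<open>Zero edge values propagate along both rays, along the left one by reflection.\<close>

lemma zero_if_zero_inside:
  assumes "\<And>x. \<bar>x\<bar> \<le> d \<Longrightarrow> u x = 0"
  shows "u x = 0"
proof -
  have "u d = 0" "u (- d) = 0" using assms d_pos by auto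
  then show ?thesis
    using assms[of x] zero_right_if_zero_at_edge[of x]
      mode.zero_right_if_zero_at_edge[OF mode_reflect, of "- x"] by (cases "\<bar>x\<bar> \<le> d") fastforce+
qed

text \<open>If \<open>l1 \<le> 0\<close>, then \<open>u\<^sup>2\<close> is convex on the well, while its derivative \<open>2 u v\<close> is nonnegative at
  the left edge and nonpositive at the right edge.\<close>

lemma zero_if_l1_nonpos:
  assumes l1: "l1 \<le> 0"
  shows "u x = 0"
proof -
  have mono: "u x * v x \<le> u y * v y" if "- d \<le> x" "x \<le> y" "y \<le> d" for x y
  proof (rule DERIV_nonneg_imp_increasing_open[OF that(2)])
    fix z assume z: "x < z" "z < y"
    then have "((\<lambda>x. u x * v x) has_real_derivative v z * v z + - l1 * u z * u z) (at z)"
      using that by (auto intro!: derivative_eq_intros du dv_in)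
    moreover have "v z * v z + - l1 * u z * u z \<ge> 0"
      using mult_nonpos_nonneg[OF l1 zero_le_square[of "u z"]] zero_le_square[of "v z"]
      unfolding minus_mult_left[symmetric] mult.assoc by linarith
    ultimately show "\<exists>D. ((\<lambda>x. u x * v x) has_real_derivative D) (at z) \<and> D \<ge> 0" by blast
  qed (intro continuous_intros cont_u cont_v_on)
  have uv: "u x * v x = 0" if "- d \<le> x" "x \<le> d" for x
    using mono[of "- d" x] mono[of x d] edge_left edge_right that by linarith
  have const: "(u x)\<^sup>2 = (u (- d))\<^sup>2" if "- d \<le> x" "x \<le> d" for x
  proof (rule DERIV_isconst2[of "- d" d])
    show "((\<lambda>x. (u x)\<^sup>2) has_real_derivative 0) (at x)" if "- d < x" "x < d" for x
      using uv[of x] that by (auto intro!: derivative_eq_intros du)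
  qed (use d_pos that in \<open>auto intro!: continuous_intros cont_u\<close>)
  \<comment> \<open>For negative \<open>l0\<close> the slope at the edge is a nonzero multiple of
    \<open>u d\<close>, so a vanishing product of the two forces \<open>u d = 0\<close>. The
    constant value of \<open>u\<^sup>2\<close> on the well is then zero.\<close>
  have "u d = 0"
  proof (cases "l0 \<ge> 0")
    case True
    then show ?thesis using zero_right_if_l0_nonneg by simp
  next
    case False
    then show ?thesis using decay_right_if_l0_neg[of d] uv[of d] d_pos by auto
  qed
  then have "u x = 0" if "\<bar>x\<bar> \<le> d" for x
    using const[of x] const[of d] that d_pos by auto
  then show ?thesis by (rule zero_if_zero_inside)
qed

section \<open>Oscillation on the well and matching at its edges\<close>

lemma inside_form:
  assumes l1: "l1 > 0" and x: "\<bar>x\<bar> \<le> d" and q: "q = sqrt l1"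
  shows "u x = u 0 * cos (q * x) + v 0 / q * sin (q * x)"
    and "v x = q * (v 0 / q * cos (q * x) - u 0 * sin (q * x))"
proof -
  have q': "q > 0" "q\<^sup>2 = l1" using l1 q by auto
  \<comment> \<open>Stated for an arbitrary mode, so that negative \<open>x\<close> is reached
    through the reflected mode, whose data at 0 are \<open>u 0\<close> and
    \<open>- v 0\<close>.\<close>
  have form: "f x = f 0 * cos (q * x) + g 0 / q * sin (q * x)
      \<and> g x = q * (g 0 / q * cos (q * x) - f 0 * sin (q * x))"
    if "mode d l0 l1 f g" "0 \<le> x" "x \<le> d" for f g x
  proof -
    interpret f: mode d l0 l1 f g by fact
    show ?thesis
      by (intro conjI; rule harmonic_solution[of q 0 x f g])
         (use q' that f.cont_u f.cont_v_on f.du f.dv_in in auto)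
  qed
  have *: "u x = u 0 * cos (q * x) + v 0 / q * sin (q * x)
      \<and> v x = q * (v 0 / q * cos (q * x) - u 0 * sin (q * x))"
  proof (cases "0 \<le> x")
    case True
    then show ?thesis using form[OF mode_axioms, of x] x by simp
  next
    case False
    then show ?thesis using form[OF mode_reflect, of "- x"] x by (simp add: algebra_simps)
  qed
  then show "u x = u 0 * cos (q * x) + v 0 / q * sin (q * x)"
    and "v x = q * (v 0 / q * cos (q * x) - u 0 * sin (q * x))" by auto
qed

text \<open>For positive \<open>l1\<close> the energy l1 u^2 + v^2 is conserved on the well, and it
  is zero at the right edge, where \<open>u\<close> and \<open>v\<close> both vanish. Nonpositive
  \<open>l1\<close> is settled by the convexity argument.\<close>

lemma zero_if_l0_nonneg:
  assumes l0: "l0 \<ge> 0"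
  shows "u x = 0"
proof (cases "l1 \<le> 0")
  case False
  then have l1: "l1 > 0" by simp
  have "l1 * (u x)\<^sup>2 + (v x)\<^sup>2 = l1 * (u d)\<^sup>2 + (v d)\<^sup>2" if "\<bar>x\<bar> \<le> d" for x
  proof (cases "x = d")
    case False
    then have "l1 * (u d)\<^sup>2 + (v d)\<^sup>2 = l1 * (u x)\<^sup>2 + (v x)\<^sup>2"
      by (intro DERIV_isconst_end[of x d])
         (use that in \<open>auto intro!: continuous_intros cont_u cont_v_on derivative_eq_intros du dv_in\<close>)
    then show ?thesis by simp
  qed simp
  moreover have "u d = 0" "v d = 0"
    using zero_right_if_l0_nonneg v_zero_right_if_l0_nonneg l0 by auto
  ultimately have "l1 * (u x)\<^sup>2 + (v x)\<^sup>2 = 0" if "\<bar>x\<bar> \<le> d" for x using that by simp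
  then have "u x = 0" if "\<bar>x\<bar> \<le> d" for x
    using l1 that by (smt (verit) mult_pos_pos zero_le_power2 zero_less_power2)
  then show ?thesis by (rule zero_if_zero_inside)
qed (use zero_if_l1_nonpos in simp)

text \<open>Adding and subtracting the decay conditions at the two edges separates the cosine
  amplitude \<open>u 0\<close> from the sine amplitude \<open>v 0 / q\<close>. Written with sin and
  cos, the equations stay meaningful at the poles of tan and cot.\<close>

lemma matching:
  assumes l0: "l0 < 0" and l1: "l1 > 0" and q: "q = sqrt l1" and k: "k = sqrt (- l0)"
  shows "u 0 = 0 \<or> q * sin (q * d) = k * cos (q * d)"
    and "v 0 = 0 \<or> q * cos (q * d) = - k * sin (q * d)"
    and "u 0 = 0 \<Longrightarrow> v 0 = 0 \<Longrightarrow> u x = 0"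
proof -
  have q': "q > 0" using l1 q by simp
  have r: "v d = - k * u d" using decay_right_if_l0_neg[OF l0] k by simp
  have l: "v (- d) = k * u (- d)"
    using mode.decay_right_if_l0_neg[OF mode_reflect l0, of d] k by simp
  note f = inside_form[OF l1 _ q]
  define b where "b = v 0 / q"
  have ub: "u d = u 0 * cos (q * d) + b * sin (q * d)" "u (-d) = u 0 * cos (q * d) - b * sin (q * d)"
    and vb: "v d = q * (b * cos (q * d) - u 0 * sin (q * d))"
      "v (-d) = q * (b * cos (q * d) + u 0 * sin (q * d))"
    using f[of d] f[of "- d"] d_pos by (auto simp: b_def)
  have "q * (u 0 * sin (q * d)) = k * (u 0 * cos (q * d))"
    using r l unfolding ub vb right_diff_distrib distrib_left by linarith
  then show "u 0 = 0 \<or> q * sin (q * d) = k * cos (q * d)"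
    by (metis mult.left_commute mult_cancel_left)
  have "q * (b * cos (q * d)) = - k * (b * sin (q * d))"
    using r l unfolding ub vb right_diff_distrib distrib_left by linarith
  then have "b = 0 \<or> q * cos (q * d) = - k * sin (q * d)"
    by (metis mult.left_commute mult_cancel_left)
  then show "v 0 = 0 \<or> q * cos (q * d) = - k * sin (q * d)" using q' by (auto simp: b_def)
  show "u x = 0" if "u 0 = 0" "v 0 = 0"
  proof (rule zero_if_zero_inside)
    show "u y = 0" if "\<bar>y\<bar> \<le> d" for y
      using f(1)[OF that] \<open>u 0 = 0\<close> \<open>v 0 = 0\<close> by simp
  qed
qed

end

section \<open>Bound states\<close>

text \<open>Nonnegativity upgrades gauge integrability to Lebesgue integrability, which descends
  from the completed measure to \<open>lborel\<close>. These tails will dominate the squares of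
  bound states.\<close>

lemma integrable_exp_ray:
  fixes a c :: real
  assumes "a > 0"
  shows "integrable lborel (\<lambda>x. indicator {c..} x * exp (- a * x))"
proof -
  have "set_integrable lebesgue {c..} (\<lambda>x. exp (- a * x))"
    by (intro nonnegative_absolutely_integrable_1 integrable_on_exp_minus_to_infinity assms) auto
  then show ?thesis
    unfolding set_integrable_def by (subst (asm) integrable_completion) auto
qed

text \<open>The outer amplitudes are forced by continuity at the edges; \<open>a\<close> is the
  amplitude of the even part and \<open>b\<close> that of the odd part.\<close>

definition bound_state :: "real \<Rightarrow> real \<Rightarrow> real \<Rightarrow> real \<Rightarrow> real \<Rightarrow> real \<Rightarrow> real" where
  "bound_state d q k a b x =
     (if x \<le> - d then (a * cos (q * d) - b * sin (q * d)) * exp (k * (x + d))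
      else if x \<le> d then a * cos (q * x) + b * sin (q * x)
      else (a * cos (q * d) + b * sin (q * d)) * exp (- k * (x - d)))"

text \<open>The derivative taken branch by branch; the matching conditions express that its branches
  also meet at the edges.\<close>

definition bound_state_deriv :: "real \<Rightarrow> real \<Rightarrow> real \<Rightarrow> real \<Rightarrow> real \<Rightarrow> real \<Rightarrow> real" where
  "bound_state_deriv d q k a b x =
     (if x \<le> - d then k * ((a * cos (q * d) - b * sin (q * d)) * exp (k * (x + d)))
      else if x \<le> d then q * (b * cos (q * x) - a * sin (q * x))
      else - k * ((a * cos (q * d) + b * sin (q * d)) * exp (- k * (x - d))))"

text \<open>The matching conditions make the slopes agree at both edges, and exponential decay
  outside the well makes the square integrable.\<close>

lemma mode_bound_state:
  assumes d: "d > 0" and l0: "l0 < 0" and l1: "l1 > 0"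
    and q: "q = sqrt l1" and k: "k = sqrt (- l0)"
    and a: "a = 0 \<or> q * sin (q * d) = k * cos (q * d)"
    and b: "b = 0 \<or> q * cos (q * d) = - k * sin (q * d)"
  shows "mode d l0 l1 (bound_state d q k a b) (bound_state_deriv d q k a b)"
proof
  have q': "l1 = q * q" and k': "k > 0" "l0 = - (k * k)" using l0 l1 q k by auto
  \<comment> \<open>Multiplication by the amplitude merges the two alternatives into one linear
    equation.\<close>
  have a': "a * (q * sin (q * d)) = a * (k * cos (q * d))" using a by auto
  have b': "b * (q * cos (q * d)) = - (b * (k * sin (q * d)))" using b by auto
  define L R where "L = a * cos (q * d) - b * sin (q * d)"
    and "R = a * cos (q * d) + b * sin (q * d)"
  \<comment> \<open>The function \<open>w\<close> joins the middle and the right piece, so gluing at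
    one point, used twice, yields all three pieces.\<close>
  define m w w' where "m = (\<lambda>x. a * cos (q * x) + b * sin (q * x))"
    and "w = (\<lambda>x. if x \<le> d then m x else R * exp (- k * (x - d)))"
    and "w' = (\<lambda>x. if x \<le> d then q * (b * cos (q * x) - a * sin (q * x))
                else - k * (R * exp (- k * (x - d))))"
  have edge: "q * (b * cos (q * d) - a * sin (q * d)) = - k * R"
    "q * (b * cos (q * (- d)) - a * sin (q * (- d))) = k * L"
    using a' b' unfolding L_def R_def by (auto simp: algebra_simps)
  have u: "bound_state d q k a b = (\<lambda>x. if x \<le> - d then L * exp (k * (x + d)) else w x)"
    by (auto simp: bound_state_def w_def L_def R_def m_def fun_eq_iff)
  have v: "bound_state_deriv d q k a b
      = (\<lambda>x. if x \<le> - d then k * (L * exp (k * (x + d))) else w' x)"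
    by (auto simp: bound_state_deriv_def w'_def L_def R_def fun_eq_iff)
  have w_edge: "w (- d) = L" "w' (- d) = k * L"
    using d edge by (auto simp: w_def w'_def m_def L_def)
  have dw: "(w has_real_derivative w' x) (at x)" for x
    unfolding w_def w'_def m_def
    by (rule has_real_derivative_glue)
       (use edge in \<open>auto intro!: derivative_eq_intros simp: R_def algebra_simps\<close>)
  show du: "(bound_state d q k a b has_real_derivative bound_state_deriv d q k a b x) (at x)" for x
    unfolding u v
    by (rule has_real_derivative_glue)
       (auto intro!: derivative_eq_intros dw simp: w_edge)
  have "continuous_on UNIV w'"
    unfolding w'_def
    by (rule continuous_on_cases_le) (use edge in \<open>auto intro!: continuous_intros\<close>)
  then show "continuous_on UNIV (bound_state_deriv d q k a b)"
    unfolding v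
    by (intro continuous_on_cases_le)
       (auto intro!: continuous_intros intro: continuous_on_subset simp: w_edge)
  show "(bound_state_deriv d q k a b has_real_derivative - l1 * bound_state d q k a b x) (at x)"
    if "\<bar>x\<bar> < d" for x
  proof (rule has_field_derivative_transform_within_open)
    show "((\<lambda>x. q * (b * cos (q * x) - a * sin (q * x))) has_real_derivative
        - l1 * bound_state d q k a b x) (at x)"
      using that q' by (auto intro!: derivative_eq_intros simp: bound_state_def algebra_simps)
  qed (use that in \<open>auto simp: bound_state_deriv_def intro: open_greaterThanLessThan[of "- d" d]\<close>)
  show "(bound_state_deriv d q k a b has_real_derivative - l0 * bound_state d q k a b x) (at x)"
    if "\<bar>x\<bar> > d" for x
  proof (cases "x > 0")
    case True
    show ?thesis
    proof (rule has_field_derivative_transform_within_open)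
      show "((\<lambda>x. - k * (R * exp (- k * (x - d)))) has_real_derivative
          - l0 * bound_state d q k a b x) (at x)"
        using that True d k' by (auto intro!: derivative_eq_intros simp: bound_state_def R_def)
    qed (use that True d in \<open>auto simp: bound_state_deriv_def R_def intro: open_greaterThan[of d]\<close>)
  next
    case False
    show ?thesis
    proof (rule has_field_derivative_transform_within_open)
      show "((\<lambda>x. k * (L * exp (k * (x + d)))) has_real_derivative
          - l0 * bound_state d q k a b x) (at x)"
        using that False d k' by (auto intro!: derivative_eq_intros simp: bound_state_def L_def)
    qed (use that False d in \<open>auto simp: bound_state_deriv_def L_def intro: open_lessThan[of "- d"]\<close>)
  qed
  let ?E = "\<lambda>x. indicator {d..} x * exp (- (2 * k) * x) :: real"
  have "integrable lborel ?E"
    by (rule integrable_exp_ray) (use k' in simp)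
  moreover have "integrable lborel (\<lambda>x. ?E (- x))"
    using lborel_integrable_real_affine[OF \<open>integrable lborel ?E\<close>, of "-1" 0] by simp
  \<comment> \<open>A majorant of the square: both tails, with exp (2 k d) because their decay is
    measured from the edges, and (|a| + |b|)^2 on the well.\<close>
  moreover define B where "B = (\<lambda>x. L\<^sup>2 * exp (2 * k * d) * ?E (- x)
      + (\<bar>a\<bar> + \<bar>b\<bar>)\<^sup>2 * indicator {- d..d} x + R\<^sup>2 * exp (2 * k * d) * ?E x)"
  ultimately have int: "integrable lborel B"
    unfolding B_def
    by (intro Bochner_Integration.integrable_add integrable_mult_right integrable_real_indicator)
      (simp_all add: emeasure_lborel_Icc_eq)
  show "integrable lborel (\<lambda>x. (bound_state d q k a b x)\<^sup>2)"
  proof (rule Bochner_Integration.integrable_bound[OF int])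
    have "continuous_on UNIV (bound_state d q k a b)"
      by (meson DERIV_continuous_on du has_field_derivative_at_within)
    then show "(\<lambda>x. (bound_state d q k a b x)\<^sup>2) \<in> borel_measurable lborel"
      by (auto intro!: borel_measurable_continuous_onI continuous_intros)
    have mid: "(m x)\<^sup>2 \<le> (\<bar>a\<bar> + \<bar>b\<bar>)\<^sup>2" for x
    proof -
      have "\<bar>m x\<bar> \<le> \<bar>a\<bar> * \<bar>cos (q * x)\<bar> + \<bar>b\<bar> * \<bar>sin (q * x)\<bar>"
        unfolding m_def abs_mult[symmetric] by (rule abs_triangle_ineq)
      also have "\<dots> \<le> \<bar>a\<bar> + \<bar>b\<bar>"
        by (intro add_mono mult_left_le) auto
      finally show ?thesis by (simp add: abs_le_square_iff[symmetric])
    qed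
    have left: "(L * exp (k * (x + d)))\<^sup>2 = L\<^sup>2 * exp (2 * k * d) * exp (- (2 * k) * (- x))" for x
      by (simp add: power_mult_distrib exp_double[symmetric] algebra_simps flip: exp_add)
    have right: "(R * exp (- k * (x - d)))\<^sup>2 = R\<^sup>2 * exp (2 * k * d) * exp (- (2 * k) * x)" for x
      by (simp add: power_mult_distrib exp_double[symmetric] algebra_simps flip: exp_add)
    have bound: "(bound_state d q k a b x)\<^sup>2 \<le> B x" for x
    proof -
      consider "x \<le> - d" | "- d < x" "x \<le> d" | "d < x" by linarith
      then show ?thesis
      proof cases
        case 1
        then show ?thesis unfolding u B_def using left[of x] d by (simp add: indicator_def)
      next
        case 2
        then show ?thesis unfolding u w_def B_def using mid[of x] d
          by (simp add: indicator_def add_increasing2)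
      next
        case 3
        then show ?thesis unfolding u w_def B_def using right[of x] d by (simp add: indicator_def)
      qed
    qed
    show "AE x in lborel. norm ((bound_state d q k a b x)\<^sup>2) \<le> norm (B x)"
      by (rule AE_I2) (simp add: order_trans[OF bound abs_ge_self])
  qed
qed (rule d)

text \<open>The branches are not mirror images at the edges: - d belongs to the left one and d to
  the middle one. The common edge values rescue the symmetry, whence the separate case |x| =
  d.\<close>

lemma bound_state_even: "d > 0 \<Longrightarrow> bound_state d q k a 0 (- x) = bound_state d q k a 0 x"
  by (cases "\<bar>x\<bar> = d") (auto simp: bound_state_def abs_if algebra_simps split: if_splits)

lemma bound_state_odd: "d > 0 \<Longrightarrow> bound_state d q k 0 b (- x) = - bound_state d q k 0 b x"
  by (cases "\<bar>x\<bar> = d") (auto simp: bound_state_def abs_if algebra_simps split: if_splits)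

section \<open>Translation between eigenfunctions and real modes\<close>

lemma lam_potential: "g\<^sup>2 * \<rho> / (\<omega> - \<Omega>) - \<omega> = - lam g \<Omega> \<rho> \<omega>"
  by (simp add: lam_def)

text \<open>The equation has real coefficients, so the real and imaginary parts of \<psi> solve it
  separately, with the parts of one complex derivative \<open>D\<close> as slopes.\<close>

lemma eigenfunction_modes:
  assumes "is_eigenfunction g \<Omega> d \<rho>0 \<rho>1 \<omega> \<psi>" and d: "d > 0"
  obtains D where
    "mode d (lam g \<Omega> \<rho>0 \<omega>) (lam g \<Omega> \<rho>1 \<omega>) (\<lambda>x. Re (\<psi> x)) (\<lambda>x. Re (D x))"
    "mode d (lam g \<Omega> \<rho>0 \<omega>) (lam g \<Omega> \<rho>1 \<omega>) (\<lambda>x. Im (\<psi> x)) (\<lambda>x. Im (D x))"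
proof -
  have sq: "square_integrable \<psi>" and C1: "\<psi> C1_differentiable_on UNIV"
    and eq: "\<And>x. x \<notin> {-d, d} \<Longrightarrow>
        \<exists>\<psi>2. ((\<lambda>t. vector_derivative \<psi> (at t)) has_vector_derivative \<psi>2) (at x) \<and>
           - \<psi>2 + (g\<^sup>2 * atom_density d \<rho>0 \<rho>1 x / (\<omega> - \<Omega>)) *\<^sub>R \<psi> x = \<omega> *\<^sub>R \<psi> x"
    using assms by (auto simp: is_eigenfunction_def)
  define D where "D = (\<lambda>t. vector_derivative \<psi> (at t))"
  have D: "(\<psi> has_vector_derivative D x) (at x)" for x
    using C1 unfolding D_def C1_differentiable_on_def
    by (metis UNIV_I vector_derivative_at)
  have cont_D: "continuous_on UNIV D"
    using C1 unfolding D_def C1_differentiable_on_eq by simp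
  have DD: "(D has_vector_derivative
      (- lam g \<Omega> (if \<bar>x\<bar> \<le> d then \<rho>1 else \<rho>0) \<omega>) *\<^sub>R \<psi> x) (at x)"
    if "x \<notin> {-d, d}" for x
  proof -
    from eq[OF that] obtain \<psi>2 where \<psi>2: "(D has_vector_derivative \<psi>2) (at x)"
      "- \<psi>2 + (g\<^sup>2 * atom_density d \<rho>0 \<rho>1 x / (\<omega> - \<Omega>)) *\<^sub>R \<psi> x = \<omega> *\<^sub>R \<psi> x"
      unfolding D_def by auto
    then have "\<psi>2 = (g\<^sup>2 * atom_density d \<rho>0 \<rho>1 x / (\<omega> - \<Omega>) - \<omega>) *\<^sub>R \<psi> x"
      by (simp add: algebra_simps)
    with \<psi>2(1) show ?thesis by (simp add: lam_potential atom_density_def)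
  qed
  have meas: "\<psi> \<in> borel_measurable lborel" and int: "integrable lborel (\<lambda>x. (cmod (\<psi> x))\<^sup>2)"
    using sq by (auto simp: square_integrable_def)
  have "mode d (lam g \<Omega> \<rho>0 \<omega>) (lam g \<Omega> \<rho>1 \<omega>) (\<lambda>x. Re (\<psi> x)) (\<lambda>x. Re (D x))"
  proof
    show "((\<lambda>x. Re (D x)) has_real_derivative - lam g \<Omega> \<rho>1 \<omega> * Re (\<psi> x)) (at x)"
      if "\<bar>x\<bar> < d" for x
      using has_field_derivative_Re[OF DD[of x]] that d by (cases "x = d \<or> x = - d") auto
    show "((\<lambda>x. Re (D x)) has_real_derivative - lam g \<Omega> \<rho>0 \<omega> * Re (\<psi> x)) (at x)"
      if "\<bar>x\<bar> > d" for x
      using has_field_derivative_Re[OF DD[of x]] that d by (cases "x = d \<or> x = - d") auto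
    show "integrable lborel (\<lambda>x. (Re (\<psi> x))\<^sup>2)"
      by (rule Bochner_Integration.integrable_bound[OF int])
         (use meas in \<open>auto simp: cmod_power2\<close>)
  qed (auto intro!: d has_field_derivative_Re[OF D] continuous_intros cont_D)
  moreover have "mode d (lam g \<Omega> \<rho>0 \<omega>) (lam g \<Omega> \<rho>1 \<omega>) (\<lambda>x. Im (\<psi> x)) (\<lambda>x. Im (D x))"
  proof
    show "((\<lambda>x. Im (D x)) has_real_derivative - lam g \<Omega> \<rho>1 \<omega> * Im (\<psi> x)) (at x)"
      if "\<bar>x\<bar> < d" for x
      using has_field_derivative_Im[OF DD[of x]] that d by (cases "x = d \<or> x = - d") auto
    show "((\<lambda>x. Im (D x)) has_real_derivative - lam g \<Omega> \<rho>0 \<omega> * Im (\<psi> x)) (at x)"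
      if "\<bar>x\<bar> > d" for x
      using has_field_derivative_Im[OF DD[of x]] that d by (cases "x = d \<or> x = - d") auto
    show "integrable lborel (\<lambda>x. (Im (\<psi> x))\<^sup>2)"
      by (rule Bochner_Integration.integrable_bound[OF int])
         (use meas in \<open>auto simp: cmod_power2\<close>)
  qed (auto intro!: d has_field_derivative_Im[OF D] continuous_intros cont_D)
  ultimately show thesis by (rule that)
qed

lemma eigenfunction_of_mode:
  assumes "mode d (lam g \<Omega> \<rho>0 \<omega>) (lam g \<Omega> \<rho>1 \<omega>) u v"
    and "\<omega> \<noteq> \<Omega>" and nz: "u x \<noteq> 0"
  shows "is_eigenfunction g \<Omega> d \<rho>0 \<rho>1 \<omega> (\<lambda>x. complex_of_real (u x))"
proof -
  interpret mode d "lam g \<Omega> \<rho>0 \<omega>" "lam g \<Omega> \<rho>1 \<omega>" u v by fact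
  have D: "((\<lambda>x. complex_of_real (u x)) has_vector_derivative complex_of_real (v x)) (at x)" for x
    by (rule has_vector_derivative_of_real[OF du])
  have vd: "(\<lambda>t. vector_derivative (\<lambda>x. complex_of_real (u x)) (at t)) = (\<lambda>x. complex_of_real (v x))"
    using vector_derivative_at[OF D] by auto
  have "(v has_real_derivative (g\<^sup>2 * atom_density d \<rho>0 \<rho>1 x / (\<omega> - \<Omega>) - \<omega>) * u x) (at x)"
    if "x \<notin> {-d, d}" for x
    using that dv_in[of x] dv_out[of x] unfolding lam_potential atom_density_def
    by (cases "\<bar>x\<bar> \<le> d") (auto simp: abs_if split: if_splits)
  note DD = has_vector_derivative_of_real[OF this, where 'a = complex]
  have "\<exists>\<psi>2. ((\<lambda>x. complex_of_real (v x)) has_vector_derivative \<psi>2) (at x) \<and>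
      - \<psi>2 + (g\<^sup>2 * atom_density d \<rho>0 \<rho>1 x / (\<omega> - \<Omega>)) *\<^sub>R complex_of_real (u x)
        = \<omega> *\<^sub>R complex_of_real (u x)" if "x \<notin> {-d, d}" for x
    by (rule exI, rule conjI[OF DD[OF that]]) (simp add: scaleR_conv_of_real algebra_simps)
  moreover have "(\<lambda>x. complex_of_real (u x)) C1_differentiable_on UNIV"
    unfolding C1_differentiable_on_def
    by (intro exI[of _ "\<lambda>x. complex_of_real (v x)"]) (auto intro!: D continuous_intros cont_v)
  moreover have "square_integrable (\<lambda>x. complex_of_real (u x))"
    unfolding square_integrable_def using sq
    by (auto intro!: borel_measurable_continuous_onI continuous_intros cont_u)
  ultimately show ?thesis
    using assms unfolding is_eigenfunction_def vd by auto
qed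

text \<open>A nonzero complex value has a nonzero real or imaginary part, and both parts inherit the
  parity of \<psi>.\<close>

lemma eigenfunction_nonzero_part:
  assumes "is_eigenfunction g \<Omega> d \<rho>0 \<rho>1 \<omega> \<psi>" and d: "d > 0"
  obtains u v where "mode d (lam g \<Omega> \<rho>0 \<omega>) (lam g \<Omega> \<rho>1 \<omega>) u v" "\<exists>x. u x \<noteq> 0"
    "even_function \<psi> \<Longrightarrow> (\<And>x. u (- x) = u x)" "odd_function \<psi> \<Longrightarrow> (\<And>x. u (- x) = - u x)"
proof -
  obtain D where D:
    "mode d (lam g \<Omega> \<rho>0 \<omega>) (lam g \<Omega> \<rho>1 \<omega>) (\<lambda>x. Re (\<psi> x)) (\<lambda>x. Re (D x))"
    "mode d (lam g \<Omega> \<rho>0 \<omega>) (lam g \<Omega> \<rho>1 \<omega>) (\<lambda>x. Im (\<psi> x)) (\<lambda>x. Im (D x))"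
    using eigenfunction_modes assms by blast
  obtain x where "\<psi> x \<noteq> 0" using assms by (auto simp: is_eigenfunction_def)
  then consider "Re (\<psi> x) \<noteq> 0" | "Im (\<psi> x) \<noteq> 0" by (auto simp: complex_eq_iff)
  then show thesis
    by cases (rule that[OF D(1)] that[OF D(2)]; auto simp: even_function_def odd_function_def)+
qed

lemma eigenvalue_signs:
  assumes "is_eigenvalue g \<Omega> d \<rho>0 \<rho>1 \<omega>" and d: "d > 0"
  shows "lam g \<Omega> \<rho>0 \<omega> < 0" "lam g \<Omega> \<rho>1 \<omega> > 0"
proof -
  obtain u v where "mode d (lam g \<Omega> \<rho>0 \<omega>) (lam g \<Omega> \<rho>1 \<omega>) u v" and nz: "\<exists>x. u x \<noteq> 0"
    using assms unfolding is_eigenvalue_def by (metis eigenfunction_nonzero_part)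
  then interpret mode d "lam g \<Omega> \<rho>0 \<omega>" "lam g \<Omega> \<rho>1 \<omega>" u v by simp
  show "lam g \<Omega> \<rho>0 \<omega> < 0" using zero_if_l0_nonneg nz not_less by blast
  show "lam g \<Omega> \<rho>1 \<omega> > 0" using zero_if_l1_nonpos nz not_less by blast
qed

section \<open>Matching conditions for even and odd eigenfunctions\<close>

context
  fixes g \<Omega> d \<rho>0 \<rho>1 \<omega> q k :: real
  assumes d: "d > 0" and ne: "\<omega> \<noteq> \<Omega>"
    and l0: "lam g \<Omega> \<rho>0 \<omega> < 0" and l1: "lam g \<Omega> \<rho>1 \<omega> > 0"
    and q: "q = wavenumber g \<Omega> \<rho>1 \<omega>" and k: "k = kappa g \<Omega> \<rho>0 \<omega>"
begin

text \<open>An even function has slope zero at 0, so its cosine amplitude is nonzero and the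
  corresponding matching condition must hold. Conversely, the amplitudes 1 and 0 give an even bound
  state.\<close>

lemma even_eigenfunction_iff:
  "(\<exists>\<psi>. is_eigenfunction g \<Omega> d \<rho>0 \<rho>1 \<omega> \<psi> \<and> even_function \<psi>)
     \<longleftrightarrow> q * sin (q * d) = k * cos (q * d)"
proof
  assume "\<exists>\<psi>. is_eigenfunction g \<Omega> d \<rho>0 \<rho>1 \<omega> \<psi> \<and> even_function \<psi>"
  then obtain u v where "mode d (lam g \<Omega> \<rho>0 \<omega>) (lam g \<Omega> \<rho>1 \<omega>) u v" and nz: "\<exists>x. u x \<noteq> 0"
    and ev: "\<And>x. u (- x) = u x"
    using d by (metis eigenfunction_nonzero_part)
  then interpret mode d "lam g \<Omega> \<rho>0 \<omega>" "lam g \<Omega> \<rho>1 \<omega>" u v by simp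
  have "(u has_real_derivative - v 0) (at 0)"
    using mode.du[OF mode_reflect, of 0] ev by simp
  then have "v 0 = 0" using du[of 0] DERIV_unique by fastforce
  then show "q * sin (q * d) = k * cos (q * d)"
    using matching[OF l0 l1 q[unfolded wavenumber_def] k[unfolded kappa_def]] nz by blast
next
  assume "q * sin (q * d) = k * cos (q * d)"
  then have "mode d (lam g \<Omega> \<rho>0 \<omega>) (lam g \<Omega> \<rho>1 \<omega>)
      (bound_state d q k 1 0) (bound_state_deriv d q k 1 0)"
    by (intro mode_bound_state d l0 l1) (auto simp: q k wavenumber_def kappa_def)
  moreover have "bound_state d q k 1 0 0 \<noteq> 0" using d by (simp add: bound_state_def)
  ultimately have "is_eigenfunction g \<Omega> d \<rho>0 \<rho>1 \<omega> (\<lambda>x. complex_of_real (bound_state d q k 1 0 x))"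
    by (rule eigenfunction_of_mode[OF _ ne])
  then show "\<exists>\<psi>. is_eigenfunction g \<Omega> d \<rho>0 \<rho>1 \<omega> \<psi> \<and> even_function \<psi>"
    using bound_state_even[OF d] by (auto simp: even_function_def)
qed

text \<open>An odd function is zero at 0, which leaves only the sine amplitude; conversely, the
  amplitudes 0 and 1 give an odd bound state.\<close>

lemma odd_eigenfunction_iff:
  "(\<exists>\<psi>. is_eigenfunction g \<Omega> d \<rho>0 \<rho>1 \<omega> \<psi> \<and> odd_function \<psi>)
     \<longleftrightarrow> q * cos (q * d) = - k * sin (q * d)"
proof
  assume "\<exists>\<psi>. is_eigenfunction g \<Omega> d \<rho>0 \<rho>1 \<omega> \<psi> \<and> odd_function \<psi>"
  then obtain u v where "mode d (lam g \<Omega> \<rho>0 \<omega>) (lam g \<Omega> \<rho>1 \<omega>) u v" and nz: "\<exists>x. u x \<noteq> 0"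
    and od: "\<And>x. u (- x) = - u x"
    using d by (metis eigenfunction_nonzero_part)
  then interpret mode d "lam g \<Omega> \<rho>0 \<omega>" "lam g \<Omega> \<rho>1 \<omega>" u v by simp
  have "u 0 = 0" using od[of 0] by simp
  then show "q * cos (q * d) = - k * sin (q * d)"
    using matching[OF l0 l1 q[unfolded wavenumber_def] k[unfolded kappa_def]] nz by blast
next
  assume match: "q * cos (q * d) = - k * sin (q * d)"
  then have "mode d (lam g \<Omega> \<rho>0 \<omega>) (lam g \<Omega> \<rho>1 \<omega>)
      (bound_state d q k 0 1) (bound_state_deriv d q k 0 1)"
    by (intro mode_bound_state d l0 l1) (auto simp: q k wavenumber_def kappa_def)
  \<comment> \<open>The sine vanishes at 0, so nonvanishing is tested at a point of the well whose
    phase lies in (0, \<pi>/2].\<close>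
  moreover have "bound_state d q k 0 1 (min d (pi / 2 / q)) \<noteq> 0"
  proof -
    have q0: "q > 0" using q l1 by (simp add: wavenumber_def)
    let ?x = "min d (pi / 2 / q)"
    have x: "?x > 0" "?x \<le> d" using d q0 by auto
    have "q * ?x \<le> pi / 2"
      using mult_left_mono[of ?x "pi / 2 / q" q] q0 by simp
    then have "sin (q * ?x) > 0"
      using q0 x pi_gt_zero by (intro sin_gt_zero mult_pos_pos) linarith+
    then show ?thesis using x d by (simp add: bound_state_def)
  qed
  ultimately have "is_eigenfunction g \<Omega> d \<rho>0 \<rho>1 \<omega> (\<lambda>x. complex_of_real (bound_state d q k 0 1 x))"
    by (rule eigenfunction_of_mode[OF _ ne])
  then show "\<exists>\<psi>. is_eigenfunction g \<Omega> d \<rho>0 \<rho>1 \<omega> \<psi> \<and> odd_function \<psi>"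
    using bound_state_odd[OF d] by (auto simp: odd_function_def)
qed

text \<open>A nonzero mode of any shape has \<open>u 0\<close> or \<open>v 0\<close> nonzero, and
  each forces its own matching condition. So every eigenvalue already has an even or an odd
  eigenfunction.\<close>

lemma eigenvalue_iff_matching:
  "is_eigenvalue g \<Omega> d \<rho>0 \<rho>1 \<omega>
     \<longleftrightarrow> q * sin (q * d) = k * cos (q * d) \<or> q * cos (q * d) = - k * sin (q * d)"
proof
  assume "is_eigenvalue g \<Omega> d \<rho>0 \<rho>1 \<omega>"
  then obtain u v where "mode d (lam g \<Omega> \<rho>0 \<omega>) (lam g \<Omega> \<rho>1 \<omega>) u v" and nz: "\<exists>x. u x \<noteq> 0"
    using d unfolding is_eigenvalue_def by (metis eigenfunction_nonzero_part)
  then interpret mode d "lam g \<Omega> \<rho>0 \<omega>" "lam g \<Omega> \<rho>1 \<omega>" u v by simp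
  show "q * sin (q * d) = k * cos (q * d) \<or> q * cos (q * d) = - k * sin (q * d)"
    using matching[OF l0 l1 q[unfolded wavenumber_def] k[unfolded kappa_def]] nz by blast
qed (use even_eigenfunction_iff odd_eigenfunction_iff is_eigenvalue_def in blast)

end

text \<open>At a pole of tan both sides are false: tan t takes the default value 0 while k is
  positive, and q sin t is nonzero while cos t is zero.\<close>

lemma tan_equation_iff:
  fixes q k t :: real
  assumes "q > 0" "k > 0"
  shows "q * tan t = k \<longleftrightarrow> q * sin t = k * cos t"
proof (cases "cos t = 0")
  case True
  then have "sin t \<noteq> 0" using sin_cos_squared_add[of t] by auto
  then show ?thesis using True assms by (simp add: tan_def)
qed (simp add: tan_def field_simps)

text \<open>At a pole of cot the default value 0 and the nonzero cos t again make both sides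
  false.\<close>

lemma cot_equation_iff:
  fixes q k t :: real
  assumes "q > 0" "k > 0"
  shows "- q * cot t = k \<longleftrightarrow> q * cos t = - k * sin t"
proof (cases "sin t = 0")
  case True
  then have "cos t \<noteq> 0" using sin_cos_squared_add[of t] by auto
  then show ?thesis using True assms by (simp add: cot_def)
qed (auto simp: cot_def field_simps)

section \<open>Counting the eigenvalues\<close>

lemma lam_less:
  assumes "g > 0" "\<rho> > 0" "x < y" "y < \<Omega> \<or> \<Omega> < x"
  shows "lam g \<Omega> \<rho> x < lam g \<Omega> \<rho> y"
proof -
  \<comment> \<open>Both points lie on the same side of the pole, where 1 / (\<omega> - \<Omega>)
    decreases.\<close>
  have "(x - \<Omega>) * (y - \<Omega>) > 0"
    using assms by (auto simp: zero_less_mult_iff)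
  moreover from this have "1 / (x - \<Omega>) - 1 / (y - \<Omega>) = (y - x) / ((x - \<Omega>) * (y - \<Omega>))"
    by (subst diff_frac_eq) auto
  ultimately have "1 / (y - \<Omega>) < 1 / (x - \<Omega>)"
    using assms(3) by (metis diff_gt_0_iff_gt divide_pos_pos)
  then have "g\<^sup>2 * \<rho> * (1 / (y - \<Omega>)) < g\<^sup>2 * \<rho> * (1 / (x - \<Omega>))"
    using assms by (intro mult_strict_left_mono) auto
  then show ?thesis using assms(3) by (simp add: lam_def)
qed

text \<open>The sign of this difference tells the side of the pole on which \<omega> lies; at a zero
  of \<open>lam\<close> for \<rho>0 it supplies the radicands of \<open>K_minus\<close> and
  \<open>K_plus\<close>.\<close>

lemma lam_diff: "lam g \<Omega> \<rho>1 \<omega> - lam g \<Omega> \<rho>0 \<omega> = g\<^sup>2 * (\<rho>1 - \<rho>0) / (\<Omega> - \<omega>)"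
proof -
  have "g\<^sup>2 * (\<rho>1 - \<rho>0) / (\<Omega> - \<omega>) = - (g\<^sup>2 * (\<rho>1 - \<rho>0) / (\<omega> - \<Omega>))"
    by (metis minus_diff_eq minus_divide_right)
  then show ?thesis by (simp add: lam_def algebra_simps diff_divide_distrib)
qed

lemma lam_zero_iff:
  assumes "\<omega> \<noteq> \<Omega>"
  shows "lam g \<Omega> \<rho> \<omega> = 0 \<longleftrightarrow> \<omega> * (\<omega> - \<Omega>) = g\<^sup>2 * \<rho>"
  using assms by (simp add: lam_def field_simps)

text \<open>Away from the pole the zeros of \<open>lam\<close> are the roots of \<omega> (\<omega> -
  \<Omega>) = g^2 \<rho>. The square root exceeds \<Omega>, which puts the two roots on opposite
  sides of the pole.\<close>

lemma
  assumes "g > 0" "\<Omega> > 0" "\<rho> > 0"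
  shows omega_minus_less: "omega_minus g \<Omega> \<rho> < \<Omega>"
    and omega_plus_greater: "\<Omega> < omega_plus g \<Omega> \<rho>"
    and lam_omega_minus: "lam g \<Omega> \<rho> (omega_minus g \<Omega> \<rho>) = 0"
    and lam_omega_plus: "lam g \<Omega> \<rho> (omega_plus g \<Omega> \<rho>) = 0"
proof -
  define s where "s = sqrt (\<Omega>\<^sup>2 + 4 * g\<^sup>2 * \<rho>)"
  have s2: "s * s = \<Omega>\<^sup>2 + 4 * g\<^sup>2 * \<rho>" using assms by (simp add: s_def)
  have "\<Omega> < s" unfolding s_def using assms by (intro real_less_rsqrt) simp
  then show m: "omega_minus g \<Omega> \<rho> < \<Omega>" and p: "\<Omega> < omega_plus g \<Omega> \<rho>"
    using assms unfolding omega_minus_def omega_plus_def s_def[symmetric] by auto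
  show "lam g \<Omega> \<rho> (omega_minus g \<Omega> \<rho>) = 0"
  proof (subst lam_zero_iff)
    have "1 / 2 * (\<Omega> - s) * (1 / 2 * (\<Omega> - s) - \<Omega>) = (s * s - \<Omega>\<^sup>2) / 4"
      by (simp add: field_simps power2_eq_square)
    then show "omega_minus g \<Omega> \<rho> * (omega_minus g \<Omega> \<rho> - \<Omega>) = g\<^sup>2 * \<rho>"
      unfolding omega_minus_def s_def[symmetric] using s2 by simp
  qed (use m in simp)
  show "lam g \<Omega> \<rho> (omega_plus g \<Omega> \<rho>) = 0"
  proof (subst lam_zero_iff)
    have "1 / 2 * (\<Omega> + s) * (1 / 2 * (\<Omega> + s) - \<Omega>) = (s * s - \<Omega>\<^sup>2) / 4"
      by (simp add: field_simps power2_eq_square)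
    then show "omega_plus g \<Omega> \<rho> * (omega_plus g \<Omega> \<rho> - \<Omega>) = g\<^sup>2 * \<rho>"
      unfolding omega_plus_def s_def[symmetric] using s2 by simp
  qed (use p in simp)
qed

lemma continuous_on_lam: "\<Omega> \<notin> S \<Longrightarrow> continuous_on S (lam g \<Omega> \<rho>)"
  unfolding lam_def by (intro continuous_intros) auto

section \<open>Counting solutions of the matching conditions by the phase\<close>

lemma sin_or_cos_zero_iff:
  fixes t :: real
  shows "sin t = 0 \<or> cos t = 0 \<longleftrightarrow> (\<exists>i::int. t = of_int i * (pi / 2))"
proof -
  \<comment> \<open>Doubling the angle merges the two families of zeros into one lattice.\<close>
  have "sin t = 0 \<or> cos t = 0 \<longleftrightarrow> sin (2 * t) = 0" by (simp add: sin_double)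
  also have "\<dots> \<longleftrightarrow> (\<exists>i::int. t = of_int i * (pi / 2))"
    unfolding sin_zero_iff_int2 by (simp add: field_simps)
  finally show ?thesis .
qed

text \<open>Put \<open>q = R cos \<phi>\<close> and \<open>k = R sin \<phi>\<close>.  The two matching conditions become
  \<open>sin (q d - \<phi>) = 0\<close> and \<open>cos (q d - \<phi>) = 0\<close>.  Unlike \<open>arctan (k / q)\<close>, the formula
  \<open>\<phi> = arccos (q / R)\<close> is continuous up to the left end point, where \<open>q = 0\<close>.\<close>

lemma card_matching_solutions:
  fixes \<Lambda>0 \<Lambda>1 :: "real \<Rightarrow> real" and d l r :: real
  assumes lr: "l < r" and d: "d > 0"
    and cont: "continuous_on {l..r} \<Lambda>0" "continuous_on {l..r} \<Lambda>1"
    and mono: "strict_mono_on {l..r} \<Lambda>0" "strict_mono_on {l..r} \<Lambda>1"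
    and zero: "\<Lambda>1 l = 0" "\<Lambda>0 r = 0"
  defines "q \<equiv> \<lambda>x. sqrt (\<Lambda>1 x)" and "k \<equiv> \<lambda>x. sqrt (- \<Lambda>0 x)"
  defines "S \<equiv> {x \<in> {l<..<r}. q x * sin (q x * d) = k x * cos (q x * d)
                  \<or> q x * cos (q x * d) = - k x * sin (q x * d)}"
  shows "finite S \<and> card S = card {m::nat. real m * pi / 2 < q r * d}"
proof -
  define R where "R = (\<lambda>x. sqrt (\<Lambda>1 x - \<Lambda>0 x))"
  define \<phi> where "\<phi> = (\<lambda>x. arccos (q x / R x))"
  define F where "F = (\<lambda>x. q x * d - \<phi> x)"
  have less0: "\<Lambda>0 x < \<Lambda>0 y" and less1: "\<Lambda>1 x < \<Lambda>1 y" if "l \<le> x" "x < y" "y \<le> r" for x y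
    using mono that unfolding strict_mono_on_def by auto
  have nonneg: "0 \<le> \<Lambda>1 x" "\<Lambda>0 x \<le> 0" "\<Lambda>0 x < \<Lambda>1 x" if "x \<in> {l..r}" for x
  proof -
    show "0 \<le> \<Lambda>1 x" using less1[of l x] zero that by (cases "x = l") auto
    show "\<Lambda>0 x \<le> 0" using less0[of x r] zero that by (cases "x = r") auto
    show "\<Lambda>0 x < \<Lambda>1 x"
      using less1[of l x] less0[of x r] less0[of l r] zero that lr by (cases "x = l"; cases "x = r") auto
  qed
  have ratio: "0 \<le> q x / R x" "q x / R x \<le> 1" if "x \<in> {l..r}" for x
    using nonneg[OF that] by (auto simp: q_def R_def)
  have F_mono: "F x < F y" if "l \<le> x" "x < y" "y \<le> r" for x y
  proof -
    have xy: "x \<in> {l..r}" "y \<in> {l..r}" using that by auto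
    \<comment> \<open>The square of q / R is \<Lambda>1 / (\<Lambda>1 - \<Lambda>0). Its growth,
      with denominators cleared, compares products of the increasing \<Lambda>1 and the decreasing -
      \<Lambda>0.\<close>
    have "\<Lambda>1 x * - \<Lambda>0 y \<le> \<Lambda>1 x * - \<Lambda>0 x"
      using less0[OF that] nonneg[OF xy(1)] by (intro mult_left_mono) auto
    also have "\<dots> < \<Lambda>1 y * - \<Lambda>0 x"
      using less1[OF that] less0[OF that] nonneg[OF xy(2)] by (intro mult_strict_right_mono) auto
    finally have "\<Lambda>1 x * (\<Lambda>1 y - \<Lambda>0 y) < \<Lambda>1 y * (\<Lambda>1 x - \<Lambda>0 x)"
      by (simp add: algebra_simps)
    then have "\<Lambda>1 x / (\<Lambda>1 x - \<Lambda>0 x) < \<Lambda>1 y / (\<Lambda>1 y - \<Lambda>0 y)"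
      using nonneg(3)[OF xy(1)] nonneg(3)[OF xy(2)] by (simp add: divide_simps)
    then have "q x / R x < q y / R y"
      by (simp add: q_def R_def flip: real_sqrt_divide)
    then have "\<phi> y < \<phi> x"
      unfolding \<phi>_def using ratio[OF xy(1)] ratio[OF xy(2)] by (intro arccos_less_arccos) auto
    moreover have "q x * d < q y * d"
      using less1[OF that] d by (simp add: q_def)
    ultimately show ?thesis by (simp add: F_def)
  qed
  have q_cont: "continuous_on {l..r} q" unfolding q_def by (intro continuous_intros cont)
  have R_cont: "continuous_on {l..r} R" unfolding R_def by (intro continuous_intros cont)
  have F_cont: "continuous_on {l..r} F"
    unfolding F_def \<phi>_def
  proof (intro continuous_intros q_cont R_cont ballI)
    show "R x \<noteq> 0" if "x \<in> {l..r}" for x using nonneg(3)[OF that] by (simp add: R_def)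
    show "- 1 \<le> q x / R x \<and> q x / R x \<le> 1" if "x \<in> {l..r}" for x using ratio[OF that] by simp
  qed
  \<comment> \<open>At \<open>l\<close> the wave number is zero and arccos 0 = \<pi>/2; at
    \<open>r\<close> the decay rate is zero, so q = R and arccos 1 = 0.\<close>
  have F_l: "F l = - (pi / 2)"
    using zero by (simp add: F_def \<phi>_def q_def)
  have F_r: "F r = q r * d"
    using zero nonneg(3)[of r] lr by (simp add: F_def \<phi>_def q_def R_def)
  have S_iff: "x \<in> S \<longleftrightarrow> (\<exists>i::int. F x = of_int i * (pi / 2))" if x: "x \<in> {l<..<r}" for x
  proof -
    have xi: "x \<in> {l..r}" using x by simp
    have R: "R x > 0" using nonneg(3)[OF xi] by (simp add: R_def)
    have qx: "q x = R x * cos (\<phi> x)"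
      using ratio[OF xi] R by (simp add: \<phi>_def)
    have "sin (\<phi> x) = sqrt (1 - (q x / R x)\<^sup>2)"
      using ratio[OF xi] by (simp add: \<phi>_def sin_arccos)
    also have "1 - (q x / R x)\<^sup>2 = - \<Lambda>0 x / (\<Lambda>1 x - \<Lambda>0 x)"
      using nonneg[OF xi] by (simp add: power_divide q_def R_def field_simps)
    also have "sqrt \<dots> = k x / R x" unfolding k_def R_def by (rule real_sqrt_divide)
    finally have kx: "k x = R x * sin (\<phi> x)" using R by simp
    have "q x * sin (q x * d) - k x * cos (q x * d) = R x * sin (F x)"
      unfolding F_def sin_diff by (subst (1) qx, subst kx) (simp add: algebra_simps)
    moreover have "q x * cos (q x * d) + k x * sin (q x * d) = R x * cos (F x)"
      unfolding F_def cos_diff by (subst (1) qx, subst kx) (simp add: algebra_simps)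
    ultimately have "x \<in> S \<longleftrightarrow> sin (F x) = 0 \<or> cos (F x) = 0"
      using x R unfolding S_def by (smt (verit) mem_Collect_eq mult_eq_0_iff mult_minus_left)
    then show ?thesis using sin_or_cos_zero_iff by simp
  qed
  define M where "M = {m::nat. real m * pi / 2 < q r * d}"
  have "M \<subseteq> {..nat \<lceil>2 * (q r * d) / pi\<rceil>}"
  proof
    fix m assume "m \<in> M"
    then have "real m \<le> 2 * (q r * d) / pi" by (simp add: M_def field_simps)
    then have "real m \<le> real_of_int \<lceil>2 * (q r * d) / pi\<rceil>" using le_of_int_ceiling order_trans by blast
    then show "m \<in> {..nat \<lceil>2 * (q r * d) / pi\<rceil>}" by simp
  qed
  then have fin: "finite M" by (rule finite_subset) simp
  \<comment> \<open>The phases of the solutions are identified as a set of values; injectivity of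
    \<open>F\<close> then transfers the cardinality.\<close>
  have image: "F ` S = (\<lambda>m. real m * pi / 2) ` M"
  proof (intro equalityI subsetI)
    fix y assume "y \<in> F ` S"
    then obtain x where x: "x \<in> S" "y = F x" by blast
    then have xlr: "l < x" "x < r" by (auto simp: S_def)
    then obtain i :: int where i: "F x = of_int i * (pi / 2)" using x S_iff by auto
    have "- (pi / 2) < F x" "F x < q r * d" using F_mono[of l x] F_mono[of x r] xlr F_l F_r by auto
    \<comment> \<open>The strict lower bound - \<pi>/2 excludes i = -1, so the multiples start at m
      = 0.\<close>
    then have "(- 1) * (pi / 2) < of_int i * (pi / 2)" using i by simp
    then have "real_of_int i > - 1" by (rule mult_less_cancel_right_pos[THEN iffD1, rotated]) simp
    then have "i \<ge> 0" by linarith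
    then have "F x = real (nat i) * pi / 2" using i by simp
    moreover from this have "nat i \<in> M" using \<open>F x < q r * d\<close> by (simp add: M_def)
    ultimately show "y \<in> (\<lambda>m. real m * pi / 2) ` M" using x by blast
  next
    fix y assume "y \<in> (\<lambda>m. real m * pi / 2) ` M"
    then obtain m where m: "m \<in> M" "y = real m * pi / 2" by blast
    have "0 \<le> y" unfolding m(2) by simp
    then have "F l < y" using F_l pi_half_gt_zero by linarith
    moreover have "y < F r" using m F_r by (simp add: M_def)
    \<comment> \<open>Both bounds on \<open>y\<close> are strict, so the intermediate value is
      attained away from the end points.\<close>
    ultimately obtain x where x: "l \<le> x" "x \<le> r" "F x = y"
      using IVT'[of F l y r] F_cont lr by auto
    then have "x \<in> {l<..<r}" using \<open>F l < y\<close> \<open>y < F r\<close> by (auto simp: less_le)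
    moreover have "F x = of_int (int m) * (pi / 2)" using x m by simp
    ultimately have "x \<in> S" using S_iff by blast
    then show "y \<in> F ` S" using x by blast
  qed
  have inj: "inj_on F S"
  proof (rule inj_onI)
    fix x y assume "x \<in> S" "y \<in> S" "F x = F y"
    then show "x = y"
      using F_mono[of x y] F_mono[of y x] by (cases x y rule: linorder_cases) (auto simp: S_def)
  qed
  have "finite S" using fin image inj by (metis finite_imageD finite_imageI)
  moreover have "card S = card M"
    using card_image[OF inj] image card_image[of "\<lambda>m. real m * pi / 2" M]
    by (simp add: inj_on_def)
  ultimately show ?thesis by (simp add: M_def)
qed

text \<open>Treats both branches at once: the window runs from a zero of \<open>lam\<close> at
  \<rho>1 to a zero at \<rho>0 without meeting the pole. Both functions increase there, and the
  count depends on the wave number at the right end.\<close>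

lemma card_eigenvalues:
  assumes d: "d > 0" and lr: "l < r" and ne: "\<Omega> \<notin> {l..r}" and pos: "g > 0" "\<rho>0 > 0" "\<rho>1 > 0"
    and zero: "lam g \<Omega> \<rho>1 l = 0" "lam g \<Omega> \<rho>0 r = 0"
    and window: "\<And>\<omega>. \<omega> \<noteq> \<Omega> \<Longrightarrow>
      lam g \<Omega> \<rho>0 \<omega> < 0 \<and> lam g \<Omega> \<rho>1 \<omega> > 0 \<longleftrightarrow> \<omega> \<in> {l<..<r}"
  defines "E \<equiv> {\<omega>. is_eigenvalue g \<Omega> d \<rho>0 \<rho>1 \<omega>}"
  shows "E \<subseteq> {l<..<r} \<and> finite E
    \<and> card E = card {m::nat. real m * pi / 2 < sqrt (lam g \<Omega> \<rho>1 r) * d}"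
proof -
  have E: "E \<subseteq> {l<..<r}"
  proof
    fix \<omega> assume e: "\<omega> \<in> E"
    then have "\<omega> \<noteq> \<Omega>" by (auto simp: E_def is_eigenvalue_def is_eigenfunction_def)
    then show "\<omega> \<in> {l<..<r}"
      using eigenvalue_signs[OF _ d] e window unfolding E_def by blast
  qed
  have match: "\<omega> \<in> E \<longleftrightarrow>
      sqrt (lam g \<Omega> \<rho>1 \<omega>) * sin (sqrt (lam g \<Omega> \<rho>1 \<omega>) * d)
        = sqrt (- lam g \<Omega> \<rho>0 \<omega>) * cos (sqrt (lam g \<Omega> \<rho>1 \<omega>) * d)
      \<or> sqrt (lam g \<Omega> \<rho>1 \<omega>) * cos (sqrt (lam g \<Omega> \<rho>1 \<omega>) * d)
        = - sqrt (- lam g \<Omega> \<rho>0 \<omega>) * sin (sqrt (lam g \<Omega> \<rho>1 \<omega>) * d)"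
    if "\<omega> \<in> {l<..<r}" for \<omega>
  proof -
    have "\<omega> \<noteq> \<Omega>" using that ne by auto
    moreover from this have "lam g \<Omega> \<rho>0 \<omega> < 0" "lam g \<Omega> \<rho>1 \<omega> > 0"
      using window that by auto
    ultimately show ?thesis
      using eigenvalue_iff_matching[OF d, of \<omega> \<Omega> g \<rho>0 \<rho>1 _ _, OF _ _ _ refl refl]
      by (simp add: E_def wavenumber_def kappa_def)
  qed
  have mono: "strict_mono_on {l..r} (lam g \<Omega> \<rho>)" if "\<rho> > 0" for \<rho>
  proof (rule strict_mono_onI)
    fix x y assume "x \<in> {l..r}" "y \<in> {l..r}" "x < y"
    then show "lam g \<Omega> \<rho> x < lam g \<Omega> \<rho> y"
      using ne pos that by (intro lam_less) auto
  qed
  have "E = {\<omega> \<in> {l<..<r}. sqrt (lam g \<Omega> \<rho>1 \<omega>) * sin (sqrt (lam g \<Omega> \<rho>1 \<omega>) * d)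
        = sqrt (- lam g \<Omega> \<rho>0 \<omega>) * cos (sqrt (lam g \<Omega> \<rho>1 \<omega>) * d)
      \<or> sqrt (lam g \<Omega> \<rho>1 \<omega>) * cos (sqrt (lam g \<Omega> \<rho>1 \<omega>) * d)
        = - sqrt (- lam g \<Omega> \<rho>0 \<omega>) * sin (sqrt (lam g \<Omega> \<rho>1 \<omega>) * d)}"
    using E match by blast
  then show ?thesis
    using card_matching_solutions[OF lr d continuous_on_lam[OF ne] continuous_on_lam[OF ne]
        mono[OF pos(2)] mono[OF pos(3)] zero] E by simp
qed

text \<open>Since \<open>lam\<close> at \<open>\<rho>1\<close> exceeds \<open>lam\<close> at \<open>\<rho>0\<close> exactly on one side of the pole \<open>\<Omega>\<close>, only that
  branch contributes.\<close>

lemma sign_window_minus: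
  assumes pos: "g > 0" "\<Omega> > 0" "\<rho>0 > 0" "\<rho>1 > 0" and less: "\<rho>0 < \<rho>1" and ne: "\<omega> \<noteq> \<Omega>"
  shows "lam g \<Omega> \<rho>0 \<omega> < 0 \<and> lam g \<Omega> \<rho>1 \<omega> > 0
    \<longleftrightarrow> \<omega> \<in> {omega_minus g \<Omega> \<rho>1 <..< omega_minus g \<Omega> \<rho>0}"
proof -
  note om = omega_minus_less[OF pos(1,2)] lam_omega_minus[OF pos(1,2)]
  \<comment> \<open>Below the pole \<open>lam\<close> increases strictly through its zero
    \<open>omega_minus\<close>, so its sign locates \<omega>.\<close>
  have sgn: "(lam g \<Omega> \<rho> \<omega> < 0 \<longleftrightarrow> \<omega> < omega_minus g \<Omega> \<rho>) \<and>
      (lam g \<Omega> \<rho> \<omega> > 0 \<longleftrightarrow> omega_minus g \<Omega> \<rho> < \<omega>)" if "\<rho> > 0" "\<omega> < \<Omega>" for \<rho>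
    using lam_less[OF pos(1) that(1), of \<omega> "omega_minus g \<Omega> \<rho>" \<Omega>]
      lam_less[OF pos(1) that(1), of "omega_minus g \<Omega> \<rho>" \<omega> \<Omega>] om[OF that(1)] that
    by (cases \<omega> "omega_minus g \<Omega> \<rho>" rule: linorder_cases) auto
  have "\<omega> < \<Omega>" if "lam g \<Omega> \<rho>0 \<omega> < 0" "lam g \<Omega> \<rho>1 \<omega> > 0"
  proof -
    have "g\<^sup>2 * (\<rho>1 - \<rho>0) / (\<Omega> - \<omega>) > 0" using that lam_diff[of g \<Omega> \<rho>1 \<omega> \<rho>0] by simp
    moreover have "g\<^sup>2 * (\<rho>1 - \<rho>0) > 0"
      using pos less by (simp add: zero_less_mult_iff)
    ultimately show ?thesis by (auto simp: zero_less_divide_iff)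
  qed
  then show ?thesis
    using sgn[OF pos(3)] sgn[OF pos(4)] om(1)[OF pos(3)] by fastforce
qed

text \<open>For \<rho>1 < \<rho>0 a positive difference of the two values of \<open>lam\<close>
  forces \<omega> above the pole, where \<open>lam\<close> increases through
  \<open>omega_plus\<close>.\<close>

lemma sign_window_plus:
  assumes pos: "g > 0" "\<Omega> > 0" "\<rho>0 > 0" "\<rho>1 > 0" and less: "\<rho>1 < \<rho>0" and ne: "\<omega> \<noteq> \<Omega>"
  shows "lam g \<Omega> \<rho>0 \<omega> < 0 \<and> lam g \<Omega> \<rho>1 \<omega> > 0
    \<longleftrightarrow> \<omega> \<in> {omega_plus g \<Omega> \<rho>1 <..< omega_plus g \<Omega> \<rho>0}"
proof -
  note om = omega_plus_greater[OF pos(1,2)] lam_omega_plus[OF pos(1,2)]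
  have sgn: "(lam g \<Omega> \<rho> \<omega> < 0 \<longleftrightarrow> \<omega> < omega_plus g \<Omega> \<rho>) \<and>
      (lam g \<Omega> \<rho> \<omega> > 0 \<longleftrightarrow> omega_plus g \<Omega> \<rho> < \<omega>)" if "\<rho> > 0" "\<omega> > \<Omega>" for \<rho>
    using lam_less[OF pos(1) that(1), of \<omega> "omega_plus g \<Omega> \<rho>" \<Omega>]
      lam_less[OF pos(1) that(1), of "omega_plus g \<Omega> \<rho>" \<omega> \<Omega>] om[OF that(1)] that
    by (cases \<omega> "omega_plus g \<Omega> \<rho>" rule: linorder_cases) auto
  have "\<omega> > \<Omega>" if "lam g \<Omega> \<rho>0 \<omega> < 0" "lam g \<Omega> \<rho>1 \<omega> > 0"
  proof -
    have "g\<^sup>2 * (\<rho>1 - \<rho>0) / (\<Omega> - \<omega>) > 0" using that lam_diff[of g \<Omega> \<rho>1 \<omega> \<rho>0] by simp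
    moreover have "g\<^sup>2 * (\<rho>1 - \<rho>0) < 0"
      using pos less by (simp add: mult_less_0_iff)
    ultimately show ?thesis by (auto simp: zero_less_divide_iff)
  qed
  then show ?thesis
    using sgn[OF pos(3)] sgn[OF pos(4)] om(1)[OF pos(4)] by fastforce
qed

theorem mainTheorem5:
  fixes g \<Omega> d \<rho>0 \<rho>1 :: real
  assumes "g > 0" and "\<Omega> > 0" and "d > 0" and "\<rho>0 > 0" and "\<rho>1 > 0" and "\<rho>0 \<noteq> \<rho>1"
  shows
    "(\<forall>\<omega>. is_eigenvalue g \<Omega> d \<rho>0 \<rho>1 \<omega> \<longrightarrow> lam g \<Omega> \<rho>0 \<omega> < 0 \<and> lam g \<Omega> \<rho>1 \<omega> > 0) \<and>
     (\<forall>\<omega>. \<omega> \<noteq> \<Omega> \<and> lam g \<Omega> \<rho>0 \<omega> < 0 \<and> lam g \<Omega> \<rho>1 \<omega> > 0 \<longrightarrow>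
        ((\<exists>\<psi>. is_eigenfunction g \<Omega> d \<rho>0 \<rho>1 \<omega> \<psi> \<and> even_function \<psi>) \<longleftrightarrow>
           wavenumber g \<Omega> \<rho>1 \<omega> * tan (wavenumber g \<Omega> \<rho>1 \<omega> * d) = kappa g \<Omega> \<rho>0 \<omega>) \<and>
        ((\<exists>\<psi>. is_eigenfunction g \<Omega> d \<rho>0 \<rho>1 \<omega> \<psi> \<and> odd_function \<psi>) \<longleftrightarrow>
           - wavenumber g \<Omega> \<rho>1 \<omega> * cot (wavenumber g \<Omega> \<rho>1 \<omega> * d) = kappa g \<Omega> \<rho>0 \<omega>)) \<and>
     (\<rho>1 > \<rho>0 \<longrightarrow>
        {\<omega>. is_eigenvalue g \<Omega> d \<rho>0 \<rho>1 \<omega>} \<subseteq> {omega_minus g \<Omega> \<rho>1 <..< omega_minus g \<Omega> \<rho>0} \<and>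
        finite {\<omega>. is_eigenvalue g \<Omega> d \<rho>0 \<rho>1 \<omega>} \<and>
        card {\<omega>. is_eigenvalue g \<Omega> d \<rho>0 \<rho>1 \<omega>} =
          card {m::nat. real m * pi / 2 < K_minus g \<Omega> \<rho>0 \<rho>1 * d}) \<and>
     (\<rho>1 < \<rho>0 \<longrightarrow>
        {\<omega>. is_eigenvalue g \<Omega> d \<rho>0 \<rho>1 \<omega>} \<subseteq> {omega_plus g \<Omega> \<rho>1 <..< omega_plus g \<Omega> \<rho>0} \<and>
        finite {\<omega>. is_eigenvalue g \<Omega> d \<rho>0 \<rho>1 \<omega>} \<and>
        card {\<omega>. is_eigenvalue g \<Omega> d \<rho>0 \<rho>1 \<omega>} =
          card {m::nat. real m * pi / 2 < K_plus g \<Omega> \<rho>0 \<rho>1 * d})"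
proof (intro conjI allI impI; (elim conjE)?)
  fix \<omega>
  assume "is_eigenvalue g \<Omega> d \<rho>0 \<rho>1 \<omega>"
  then show "lam g \<Omega> \<rho>0 \<omega> < 0" "lam g \<Omega> \<rho>1 \<omega> > 0"
    using eigenvalue_signs \<open>d > 0\<close> by blast+
next
  fix \<omega>
  assume \<omega>: "\<omega> \<noteq> \<Omega>" "lam g \<Omega> \<rho>0 \<omega> < 0" "lam g \<Omega> \<rho>1 \<omega> > 0"
  \<comment> \<open>Positivity of both quantities is what makes the equations false at the poles of
    tan and cot.\<close>
  then have pos: "wavenumber g \<Omega> \<rho>1 \<omega> > 0" "kappa g \<Omega> \<rho>0 \<omega> > 0"
    by (auto simp: wavenumber_def kappa_def)
  show "(\<exists>\<psi>. is_eigenfunction g \<Omega> d \<rho>0 \<rho>1 \<omega> \<psi> \<and> even_function \<psi>) \<longleftrightarrow>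
      wavenumber g \<Omega> \<rho>1 \<omega> * tan (wavenumber g \<Omega> \<rho>1 \<omega> * d) = kappa g \<Omega> \<rho>0 \<omega>"
    unfolding tan_equation_iff[OF pos]
    by (rule even_eigenfunction_iff[OF \<open>d > 0\<close> \<omega> refl refl])
  show "(\<exists>\<psi>. is_eigenfunction g \<Omega> d \<rho>0 \<rho>1 \<omega> \<psi> \<and> odd_function \<psi>) \<longleftrightarrow>
      - wavenumber g \<Omega> \<rho>1 \<omega> * cot (wavenumber g \<Omega> \<rho>1 \<omega> * d) = kappa g \<Omega> \<rho>0 \<omega>"
    unfolding cot_equation_iff[OF pos]
    by (rule odd_eigenfunction_iff[OF \<open>d > 0\<close> \<omega> refl refl])
next
  assume less: "\<rho>1 > \<rho>0"
  let ?l = "omega_minus g \<Omega> \<rho>1" and ?r = "omega_minus g \<Omega> \<rho>0"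
  have "sqrt (\<Omega>\<^sup>2 + 4 * g\<^sup>2 * \<rho>0) < sqrt (\<Omega>\<^sup>2 + 4 * g\<^sup>2 * \<rho>1)"
    using less assms by simp
  then have lr: "?l < ?r" by (simp add: omega_minus_def)
  have r: "?r < \<Omega>" using omega_minus_less assms by simp
  \<comment> \<open>Since \<open>lam\<close> at \<rho>0 vanishes at \<open>?r\<close>, the
    difference identity gives the square of \<open>K_minus\<close>.\<close>
  have "lam g \<Omega> \<rho>1 ?r = g\<^sup>2 * (\<rho>1 - \<rho>0) / (\<Omega> - ?r)"
    using lam_diff[of g \<Omega> \<rho>1 ?r \<rho>0] lam_omega_minus[of g \<Omega> \<rho>0] assms by simp
  then have K: "sqrt (lam g \<Omega> \<rho>1 ?r) = K_minus g \<Omega> \<rho>0 \<rho>1" by (simp add: K_minus_def)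
  have "{\<omega>. is_eigenvalue g \<Omega> d \<rho>0 \<rho>1 \<omega>} \<subseteq> {?l<..<?r} \<and>
      finite {\<omega>. is_eigenvalue g \<Omega> d \<rho>0 \<rho>1 \<omega>} \<and>
      card {\<omega>. is_eigenvalue g \<Omega> d \<rho>0 \<rho>1 \<omega>} =
        card {m::nat. real m * pi / 2 < sqrt (lam g \<Omega> \<rho>1 ?r) * d}"
    by (rule card_eigenvalues)
       (use lr r less assms lam_omega_minus sign_window_minus in auto)
  then show "{\<omega>. is_eigenvalue g \<Omega> d \<rho>0 \<rho>1 \<omega>} \<subseteq> {?l<..<?r}"
    "finite {\<omega>. is_eigenvalue g \<Omega> d \<rho>0 \<rho>1 \<omega>}"
    "card {\<omega>. is_eigenvalue g \<Omega> d \<rho>0 \<rho>1 \<omega>} =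
      card {m::nat. real m * pi / 2 < K_minus g \<Omega> \<rho>0 \<rho>1 * d}"
    unfolding K by auto
next
  assume less: "\<rho>1 < \<rho>0"
  let ?l = "omega_plus g \<Omega> \<rho>1" and ?r = "omega_plus g \<Omega> \<rho>0"
  have "sqrt (\<Omega>\<^sup>2 + 4 * g\<^sup>2 * \<rho>1) < sqrt (\<Omega>\<^sup>2 + 4 * g\<^sup>2 * \<rho>0)"
    using less assms by simp
  then have lr: "?l < ?r" by (simp add: omega_plus_def)
  have l: "\<Omega> < ?l" using omega_plus_greater assms by simp
  have "lam g \<Omega> \<rho>1 ?r = g\<^sup>2 * (\<rho>1 - \<rho>0) / (\<Omega> - ?r)"
    using lam_diff[of g \<Omega> \<rho>1 ?r \<rho>0] lam_omega_plus[of g \<Omega> \<rho>0] assms by simp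
  \<comment> \<open>Numerator and denominator change sign together, to match the form of
    \<open>K_plus\<close>.\<close>
  also have "\<dots> = g\<^sup>2 * (\<rho>0 - \<rho>1) / (?r - \<Omega>)"
    by (metis minus_diff_eq minus_divide_divide mult_minus_right)
  finally have K: "sqrt (lam g \<Omega> \<rho>1 ?r) = K_plus g \<Omega> \<rho>0 \<rho>1" by (simp add: K_plus_def)
  have "{\<omega>. is_eigenvalue g \<Omega> d \<rho>0 \<rho>1 \<omega>} \<subseteq> {?l<..<?r} \<and>
      finite {\<omega>. is_eigenvalue g \<Omega> d \<rho>0 \<rho>1 \<omega>} \<and>
      card {\<omega>. is_eigenvalue g \<Omega> d \<rho>0 \<rho>1 \<omega>} =
        card {m::nat. real m * pi / 2 < sqrt (lam g \<Omega> \<rho>1 ?r) * d}"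
    by (rule card_eigenvalues)
       (use lr l less assms lam_omega_plus sign_window_plus in auto)
  then show "{\<omega>. is_eigenvalue g \<Omega> d \<rho>0 \<rho>1 \<omega>} \<subseteq> {?l<..<?r}"
    "finite {\<omega>. is_eigenvalue g \<Omega> d \<rho>0 \<rho>1 \<omega>}"
    "card {\<omega>. is_eigenvalue g \<Omega> d \<rho>0 \<rho>1 \<omega>} =
      card {m::nat. real m * pi / 2 < K_plus g \<Omega> \<rho>0 \<rho>1 * d}"
    unfolding K by auto
qed

end
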